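(* Let $(Y^3,g_Y)$ be an oriented 3-manifold with metric of constant curvature $\kappa\in\{1,0,-1\}$. For any symmetric 2-tensor $h\in S^2(T^*Y)$, $$E'_{g_Y}(h)=\tfrac18\not{d}^{\,2}h-\tfrac14\overset{\circ}{\nabla^2}\mathrm{tr}_Y(h)+\tfrac18\mathcal{K}_{g_Y}(\delta_Yh)-\tfrac{\kappa}{2}\mathrm{tf}(h),$$ where $E'_{g_Y}(h)$ is the linearization at $g_Y$, in the direction $h$, of the traceless Ricci tensor $E(g)=\mathrm{Ric}(g)-\frac13R_g\,g$.
   Context: $(\delta_Yh)_j=\nabla^ih_{ij}$, $\delta_Y\omega=\nabla^i\omega_i$, $\mathrm{tr}_Y$ is the $g_Y$-trace, $\mathrm{tf}(h)=h-\frac13\mathrm{tr}_Y(h)g_Y$, $\overset{\circ}{\nabla^2}u=\nabla^2u-\frac13(\Delta_{g_Y} u)g_Y$ is the traceless Hessian, $\mathcal{K}_{g_Y}(\omega)_{ij}=\nabla_i\omega_j+\nabla_j\omega_i-\frac23(\delta_Y\omega)(g_Y)_{ij}$. The Dirac-type operator is, in a local oriented orthonormal frame, $(\not{d}h)_{ij}=\mathrm{Sym}_{ij}\big(\sum_{k,l}\epsilon_{ikl}(\nabla_kh_{lj}-\nabla_lh_{kj})\big)$, with $\mathrm{Sym}_{ij}(F)=\frac12(F_{ij}+F_{ji})$ and $\epsilon_{ijk}$ the components of the volume form. *)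

theory Defs
  imports "HOL-Analysis.Analysis"
begin

section \<open>Smooth functions on open subsets of Euclidean space\<close>

definition partial :: "'n::finite \<Rightarrow> (real^'n \<Rightarrow> 'b::real_normed_vector) \<Rightarrow> real^'n \<Rightarrow> 'b" where
  "partial i f x = frechet_derivative f (at x) (axis i 1)"

primrec C_k_on :: "nat \<Rightarrow> (real^'n::finite) set \<Rightarrow> (real^'n \<Rightarrow> 'b::real_normed_vector) \<Rightarrow> bool" where
  "C_k_on 0 S f \<longleftrightarrow> continuous_on S f"
| "C_k_on (Suc k) S f \<longleftrightarrow>
     (\<forall>x\<in>S. f differentiable (at x)) \<and> (\<forall>i. C_k_on k S (partial i f))"

definition smooth_on :: "(real^'n::finite) set \<Rightarrow> (real^'n \<Rightarrow> 'b::real_normed_vector) \<Rightarrow> bool" where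
  "smooth_on S f \<longleftrightarrow> (\<forall>k. C_k_on k S f)"

definition jacobian :: "(real^'n::finite \<Rightarrow> real^'n) \<Rightarrow> real^'n \<Rightarrow> real^'n^'n" where
  "jacobian f x = matrix (frechet_derivative f (at x))"


section \<open>Oriented 3-manifolds and tensor fields\<close>

text \<open>A chart is a pair of its domain and its coordinate map. The smooth structure and the
  orientation of a manifold are both given by an atlas all of whose transition maps are smooth
  with positive Jacobian determinant.\<close>

type_synonym 'a chart = "'a set \<times> ('a \<Rightarrow> real^3)"

definition chart_image :: "'a chart \<Rightarrow> (real^3) set" where
  "chart_image c = snd c ` fst c"

definition overlap :: "'a chart \<Rightarrow> 'a chart \<Rightarrow> (real^3) set" where
  "overlap c d = snd c ` (fst c \<inter> fst d)"

definition transition :: "'a chart \<Rightarrow> 'a chart \<Rightarrow> real^3 \<Rightarrow> real^3" where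
  "transition c d = snd d \<circ> inv_into (fst c) (snd c)"

definition is_chart :: "'a topology \<Rightarrow> 'a chart \<Rightarrow> bool" where
  "is_chart Y c \<longleftrightarrow> openin Y (fst c) \<and> open (chart_image c) \<and>
     homeomorphic_map (subtopology Y (fst c)) (top_of_set (chart_image c)) (snd c)"

definition oriented_3_manifold :: "'a topology \<Rightarrow> 'a chart set \<Rightarrow> bool" where
  "oriented_3_manifold Y \<A> \<longleftrightarrow>
     Hausdorff_space Y \<and> second_countable Y \<and>
     (\<forall>c\<in>\<A>. is_chart Y c) \<and> (\<Union>c\<in>\<A>. fst c) = topspace Y \<and>
     (\<forall>c\<in>\<A>. \<forall>d\<in>\<A>. smooth_on (overlap c d) (transition c d) \<and>
        (\<forall>x\<in>overlap c d. det (jacobian (transition c d) x) > 0))"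

text \<open>A covariant 2-tensor field is given by its component functions in every chart of the atlas,
  subject to the transformation law. The components in a chart \<open>c\<close> are functions of the
  coordinates, that is, of the points of \<open>chart_image c\<close>; their values elsewhere are
  irrelevant.\<close>

type_synonym 'a tensor2 = "'a chart \<Rightarrow> real^3 \<Rightarrow> real^3^3"

definition tensor2_field :: "'a chart set \<Rightarrow> 'a tensor2 \<Rightarrow> bool" where
  "tensor2_field \<A> T \<longleftrightarrow>
     (\<forall>c\<in>\<A>. smooth_on (chart_image c) (T c)) \<and>
     (\<forall>c\<in>\<A>. \<forall>d\<in>\<A>. \<forall>x\<in>overlap c d.
        T c x = transpose (jacobian (transition c d) x) ** T d (transition c d x)
                  ** jacobian (transition c d) x)"

definition symmetric_tensor2_field :: "'a chart set \<Rightarrow> 'a tensor2 \<Rightarrow> bool" where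
  "symmetric_tensor2_field \<A> T \<longleftrightarrow> tensor2_field \<A> T \<and>
     (\<forall>c\<in>\<A>. \<forall>x\<in>chart_image c. transpose (T c x) = T c x)"

definition bil :: "real^3^3 \<Rightarrow> real^3 \<Rightarrow> real^3 \<Rightarrow> real" where
  "bil A u v = (\<Sum>i\<in>UNIV. \<Sum>j\<in>UNIV. A $ i $ j * u $ i * v $ j)"

definition pos_def :: "real^3^3 \<Rightarrow> bool" where
  "pos_def A \<longleftrightarrow> (\<forall>v. v \<noteq> 0 \<longrightarrow> bil A v v > 0)"

definition riemannian_metric :: "'a chart set \<Rightarrow> 'a tensor2 \<Rightarrow> bool" where
  "riemannian_metric \<A> g \<longleftrightarrow> symmetric_tensor2_field \<A> g \<and>
     (\<forall>c\<in>\<A>. \<forall>x\<in>chart_image c. pos_def (g c x))"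


section \<open>Riemannian geometry in a chart\<close>

text \<open>From here on, \<open>g\<close>, \<open>h\<close>, \<open>\<omega>\<close> and \<open>u\<close> are the components, in one chart, of a metric,
  a covariant 2-tensor, a 1-form and a function.\<close>

type_synonym fun_comp = "real^3 \<Rightarrow> real"
type_synonym form_comp = "real^3 \<Rightarrow> real^3"
type_synonym tensor_comp = "real^3 \<Rightarrow> real^3^3"

definition ginv :: "tensor_comp \<Rightarrow> tensor_comp" where
  "ginv g x = matrix_inv (g x)"

text \<open>\<open>christoffel g x k i j\<close> is $\Gamma^k_{ij}$.\<close>
definition christoffel :: "tensor_comp \<Rightarrow> real^3 \<Rightarrow> 3 \<Rightarrow> 3 \<Rightarrow> 3 \<Rightarrow> real" where
  "christoffel g x k i j = (1/2) * (\<Sum>l\<in>UNIV. ginv g x $ k $ l *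
     (partial i (\<lambda>y. g y $ j $ l) x + partial j (\<lambda>y. g y $ i $ l) x - partial l (\<lambda>y. g y $ i $ j) x))"

text \<open>\<open>nabla_form g \<omega> x $ i $ j\<close> is $\nabla_i\omega_j$.\<close>
definition nabla_form :: "tensor_comp \<Rightarrow> form_comp \<Rightarrow> tensor_comp" where
  "nabla_form g \<omega> x = (\<chi> i j. partial i (\<lambda>y. \<omega> y $ j) x
     - (\<Sum>k\<in>UNIV. christoffel g x k i j * \<omega> x $ k))"

text \<open>\<open>nabla_tensor g h x k i j\<close> is $\nabla_k h_{ij}$.\<close>
definition nabla_tensor :: "tensor_comp \<Rightarrow> tensor_comp \<Rightarrow> real^3 \<Rightarrow> 3 \<Rightarrow> 3 \<Rightarrow> 3 \<Rightarrow> real" where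
  "nabla_tensor g h x k i j = partial k (\<lambda>y. h y $ i $ j) x
     - (\<Sum>m\<in>UNIV. christoffel g x m k i * h x $ m $ j)
     - (\<Sum>m\<in>UNIV. christoffel g x m k j * h x $ i $ m)"

definition tr_g :: "tensor_comp \<Rightarrow> tensor_comp \<Rightarrow> fun_comp" where
  "tr_g g h x = (\<Sum>i\<in>UNIV. \<Sum>j\<in>UNIV. ginv g x $ i $ j * h x $ i $ j)"

definition tf :: "tensor_comp \<Rightarrow> tensor_comp \<Rightarrow> tensor_comp" where
  "tf g h x = h x - ((1/3) * tr_g g h x) *\<^sub>R g x"

definition div_form :: "tensor_comp \<Rightarrow> form_comp \<Rightarrow> fun_comp" where
  "div_form g \<omega> = tr_g g (nabla_form g \<omega>)"

definition div_tensor :: "tensor_comp \<Rightarrow> tensor_comp \<Rightarrow> form_comp" where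
  "div_tensor g h x = (\<chi> j. \<Sum>i\<in>UNIV. \<Sum>k\<in>UNIV. ginv g x $ i $ k * nabla_tensor g h x k i j)"

definition hessian :: "tensor_comp \<Rightarrow> fun_comp \<Rightarrow> tensor_comp" where
  "hessian g u = nabla_form g (\<lambda>y. \<chi> j. partial j u y)"

definition laplacian :: "tensor_comp \<Rightarrow> fun_comp \<Rightarrow> fun_comp" where
  "laplacian g u = tr_g g (hessian g u)"

definition tf_hessian :: "tensor_comp \<Rightarrow> fun_comp \<Rightarrow> tensor_comp" where
  "tf_hessian g u x = hessian g u x - ((1/3) * laplacian g u x) *\<^sub>R g x"

definition conf_killing :: "tensor_comp \<Rightarrow> form_comp \<Rightarrow> tensor_comp" where
  "conf_killing g \<omega> x = nabla_form g \<omega> x + transpose (nabla_form g \<omega> x)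
     - ((2/3) * div_form g \<omega> x) *\<^sub>R g x"


subsection \<open>Curvature\<close>

text \<open>\<open>riem g x i j k l\<close> is $R^i{}_{jkl}$, where
  $R(\partial_k,\partial_l)\partial_j = R^i{}_{jkl}\,\partial_i$ and
  $R(X,Y) = [\nabla_X,\nabla_Y] - \nabla_{[X,Y]}$.\<close>
definition riem :: "tensor_comp \<Rightarrow> real^3 \<Rightarrow> 3 \<Rightarrow> 3 \<Rightarrow> 3 \<Rightarrow> 3 \<Rightarrow> real" where
  "riem g x i j k l =
     partial k (\<lambda>y. christoffel g y i l j) x - partial l (\<lambda>y. christoffel g y i k j) x
     + (\<Sum>m\<in>UNIV. christoffel g x i k m * christoffel g x m l j)
     - (\<Sum>m\<in>UNIV. christoffel g x i l m * christoffel g x m k j)"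

definition ricci :: "tensor_comp \<Rightarrow> tensor_comp" where
  "ricci g x = (\<chi> j l. \<Sum>i\<in>UNIV. riem g x i j i l)"

definition scal :: "tensor_comp \<Rightarrow> fun_comp" where
  "scal g = tr_g g (ricci g)"

definition tf_ricci :: "tensor_comp \<Rightarrow> tensor_comp" where
  "tf_ricci g x = ricci g x - ((1/3) * scal g x) *\<^sub>R g x"

text \<open>$g(R(u,v)v,u) / (|u|^2|v|^2 - g(u,v)^2)$\<close>
definition sectional_curvature :: "tensor_comp \<Rightarrow> real^3 \<Rightarrow> real^3 \<Rightarrow> real^3 \<Rightarrow> real" where
  "sectional_curvature g x u v =
     bil (g x) (\<chi> i. \<Sum>j\<in>UNIV. \<Sum>k\<in>UNIV. \<Sum>l\<in>UNIV. riem g x i j k l * v $ j * u $ k * v $ l) u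
     / (bil (g x) u u * bil (g x) v v - (bil (g x) u v)\<^sup>2)"

definition constant_curvature :: "'a chart set \<Rightarrow> 'a tensor2 \<Rightarrow> real \<Rightarrow> bool" where
  "constant_curvature \<A> g \<kappa> \<longleftrightarrow>
     (\<forall>c\<in>\<A>. \<forall>x\<in>chart_image c. \<forall>u v. u \<noteq> v \<and> independent {u, v} \<longrightarrow>
        sectional_curvature (g c) x u v = \<kappa>)"


subsection \<open>The Dirac-type operator\<close>

definition volume_form :: "real^3^3 \<Rightarrow> real^3 \<Rightarrow> real^3 \<Rightarrow> real^3 \<Rightarrow> real" where
  "volume_form G u v w = sqrt (det G) * det (vector [u, v, w] :: real^3^3)"

definition oriented_orthonormal :: "real^3^3 \<Rightarrow> (3 \<Rightarrow> real^3) \<Rightarrow> bool" where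
  "oriented_orthonormal G e \<longleftrightarrow>
     (\<forall>i j. bil G (e i) (e j) = (if i = j then 1 else 0)) \<and> det (\<chi> i. e i) > 0"

definition nabla_at :: "tensor_comp \<Rightarrow> tensor_comp \<Rightarrow> real^3 \<Rightarrow> real^3 \<Rightarrow> real^3 \<Rightarrow> real^3 \<Rightarrow> real" where
  "nabla_at g h x w u v =
     (\<Sum>k\<in>UNIV. \<Sum>i\<in>UNIV. \<Sum>j\<in>UNIV. nabla_tensor g h x k i j * w $ k * u $ i * v $ j)"

definition Sym :: "(3 \<Rightarrow> 3 \<Rightarrow> real) \<Rightarrow> 3 \<Rightarrow> 3 \<Rightarrow> real" where
  "Sym F i j = (1/2) * (F i j + F j i)"

text \<open>The components of $\not{d}h$ at a point are prescribed in every oriented orthonormal basis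
  of the tangent space. Because $\nabla h$ is a tensor, the components $\nabla_k h_{lj}$ with
  respect to a local frame only depend on the values of the frame at the point. Existence and
  uniqueness of the tensor described here are contained in \<open>dirac_eq\<close> and \<open>dirac_frame\<close>
  below.\<close>
definition dirac :: "tensor_comp \<Rightarrow> tensor_comp \<Rightarrow> tensor_comp" where
  "dirac g h x = (THE D. \<forall>e. oriented_orthonormal (g x) e \<longrightarrow>
     (\<forall>i j. bil D (e i) (e j) = Sym (\<lambda>i j. \<Sum>k\<in>UNIV. \<Sum>l\<in>UNIV.
        volume_form (g x) (e i) (e k) (e l) *
        (nabla_at g h x (e k) (e l) (e j) - nabla_at g h x (e l) (e k) (e j))) i j))"

definition dirac_coord :: "tensor_comp \<Rightarrow> tensor_comp \<Rightarrow> tensor_comp" where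
  "dirac_coord g h x = (\<chi> a b. Sym (\<lambda>a b.
     \<Sum>k\<in>UNIV. \<Sum>l\<in>UNIV. \<Sum>p\<in>UNIV. \<Sum>q\<in>UNIV.
        volume_form (g x) (axis a 1) (axis k 1) (axis l 1) * ginv g x $ k $ p * ginv g x $ l $ q *
        (nabla_tensor g h x p q b - nabla_tensor g h x q p b)) a b)"

lemma bil_simps:
  "bil G (u + u') v = bil G u v + bil G u' v" "bil G u (v + v') = bil G u v + bil G u v'"
  "bil G (u - u') v = bil G u v - bil G u' v" "bil G u (v - v') = bil G u v - bil G u v'"
  "bil G (r *\<^sub>R u) v = r * bil G u v" "bil G u (r *\<^sub>R v) = r * bil G u v"
  by (simp_all add: bil_def algebra_simps sum.distrib sum_subtractf sum_distrib_left)

lemma bil_commute: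
  assumes "transpose G = G" shows "bil G u v = bil G v u"
proof -
  have "G $ i $ j = G $ j $ i" for i j
    using arg_cong[OF assms, of "\<lambda>M. M $ i $ j"] by (simp add: transpose_def)
  then have eq: "G $ i $ j * u $ i * v $ j = G $ j $ i * v $ j * u $ i" for i j
    by simp
  have "bil G u v = (\<Sum>j\<in>UNIV. \<Sum>i\<in>UNIV. G $ i $ j * u $ i * v $ j)"
    unfolding bil_def by (rule sum.swap)
  also have "\<dots> = bil G v u"
    unfolding bil_def by (intro sum.cong refl eq)
  finally show ?thesis .
qed

lemma oriented_orthonormal_exists:
  assumes sym: "transpose G = G" and pos: "pos_def G"
  shows "\<exists>e. oriented_orthonormal G e"
proof -
  define a1 :: "real^3" where "a1 = axis 1 1"
  define a2 where "a2 = axis 2 1 - (bil G (axis 2 1) a1 / bil G a1 a1) *\<^sub>R a1"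
  define a3 where "a3 = axis 3 1 - (bil G (axis 3 1) a1 / bil G a1 a1) *\<^sub>R a1
                          - (bil G (axis 3 1) a2 / bil G a2 a2) *\<^sub>R a2"
  have c1: "a1 $ 1 = 1" "a1 $ 2 = 0" "a1 $ 3 = 0" by (simp_all add: a1_def axis_def)
  have c2: "a2 $ 2 = 1" "a2 $ 3 = 0" by (simp_all add: a2_def c1 axis_def)
  have c3: "a3 $ 3 = 1" by (simp add: a3_def c1 c2 axis_def)
  have p1: "bil G a1 a1 > 0" using pos c1(1) unfolding pos_def_def by (metis zero_index zero_neq_one)
  have p2: "bil G a2 a2 > 0" using pos c2(1) unfolding pos_def_def by (metis zero_index zero_neq_one)
  have p3: "bil G a3 a3 > 0" using pos c3 unfolding pos_def_def by (metis zero_index zero_neq_one)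
  have o21: "bil G a2 a1 = 0" using p1 unfolding a2_def by (simp add: bil_simps)
  have o12: "bil G a1 a2 = 0" using o21 bil_commute[OF sym] by metis
  have o31: "bil G a3 a1 = 0" using p1 p2 unfolding a3_def by (simp add: bil_simps o21)
  have o13: "bil G a1 a3 = 0" using o31 bil_commute[OF sym] by metis
  have o32: "bil G a3 a2 = 0" using p1 p2 unfolding a3_def by (simp add: bil_simps o12)
  have o23: "bil G a2 a3 = 0" using o32 bil_commute[OF sym] by metis
  define b :: "3 \<Rightarrow> real^3" where "b i = (if i = 1 then a1 else if i = 2 then a2 else a3)" for i
  define e where "e i = (1 / sqrt (bil G (b i) (b i))) *\<^sub>R b i" for i
  have b: "b 1 = a1" "b 2 = a2" "b 3 = a3" by (simp_all add: b_def)
  have ob: "bil G (b i) (b j) = 0" if "i \<noteq> j" for i j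
    using that exhaust_3[of i] exhaust_3[of j] by (auto simp: b o12 o13 o21 o23 o31 o32)
  have pb: "bil G (b i) (b i) > 0" for i
    using exhaust_3[of i] p1 p2 p3 by (auto simp: b)
  have "bil G (e i) (e j) = (if i = j then 1 else 0)" for i j
    using pb[of i] by (auto simp: e_def bil_simps ob field_simps)
  moreover have "det (\<chi> i. e i) > 0"
    using p1 p2 p3 by (simp add: det_3 e_def b c1 c2 c3)
  ultimately show ?thesis unfolding oriented_orthonormal_def by blast
qed

lemma bil_matrix: "(\<chi> i j. bil D (e i) (e j)) = (\<chi> i. e i) ** D ** transpose (\<chi> i. e i)"
proof -
  have "bil D (e i) (e j) = ((\<chi> i. e i) ** D ** transpose (\<chi> i. e i)) $ i $ j" for i j
    by (simp add: bil_def matrix_matrix_mult_def transpose_def sum_3 algebra_simps)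
  then show ?thesis by (simp add: vec_eq_iff)
qed

lemma oriented_orthonormal_inverse:
  assumes "oriented_orthonormal G e"
  shows "(\<Sum>m\<in>UNIV. e m $ k * e m $ p) = matrix_inv G $ k $ p"
proof -
  let ?M = "(\<chi> i. e i) :: real^3^3"
  have 1: "?M ** G ** transpose ?M = mat 1"
    unfolding bil_matrix[symmetric]
    using assms by (simp add: oriented_orthonormal_def mat_def vec_eq_iff)
  then have "G ** (transpose ?M ** ?M) = mat 1"
    by (metis matrix_left_right_inverse matrix_mul_assoc)
  then have inv: "G ** (transpose ?M ** ?M) = mat 1 \<and> (transpose ?M ** ?M) ** G = mat 1"
    using matrix_left_right_inverse by blast
  then have "G ** matrix_inv G = mat 1 \<and> matrix_inv G ** G = mat 1"
    unfolding matrix_inv_def by (rule someI)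
  then have "matrix_inv G ** (G ** (transpose ?M ** ?M)) = transpose ?M ** ?M"
    by (simp add: matrix_mul_assoc)
  then have "matrix_inv G = transpose ?M ** ?M"
    using inv by simp
  then show ?thesis by (simp add: matrix_matrix_mult_def transpose_def)
qed

lemma frame_tensor_unique:
  assumes "oriented_orthonormal G e" and "\<And>i j. bil D (e i) (e j) = bil D' (e i) (e j)"
  shows "D = D'"
proof -
  let ?M = "(\<chi> i. e i) :: real^3^3"
  have eq: "?M ** D ** transpose ?M = ?M ** D' ** transpose ?M"
    unfolding bil_matrix[symmetric] by (simp add: assms(2))
  have "det ?M \<noteq> 0" using assms(1) by (simp add: oriented_orthonormal_def)
  then obtain N where N: "?M ** N = mat 1" "N ** ?M = mat 1"
    by (meson invertible_def invertible_det_nz)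
  have T: "transpose ?M ** transpose N = mat 1"
    by (metis N(2) matrix_transpose_mul transpose_mat)
  have "N ** (?M ** X ** transpose ?M) ** transpose N = X" for X
  proof -
    have "N ** (?M ** X ** transpose ?M) ** transpose N = (N ** ?M) ** X ** (transpose ?M ** transpose N)"
      by (simp only: matrix_mul_assoc)
    then show ?thesis by (simp only: N(2) T matrix_mul_lid matrix_mul_rid)
  qed
  then show ?thesis using eq by metis
qed

lemma volume_form_expand:
  "volume_form G u v w = (\<Sum>a\<in>UNIV. \<Sum>k\<in>UNIV. \<Sum>l\<in>UNIV.
     volume_form G (axis a 1) (axis k 1) (axis l 1) * u $ a * v $ k * w $ l)"
  by (simp add: volume_form_def det_3 sum_3 axis_def algebra_simps)

lemma frame_contraction:
  fixes V C :: "3 \<Rightarrow> 3 \<Rightarrow> 3 \<Rightarrow> real" and e :: "3 \<Rightarrow> real^3"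
  shows "(\<Sum>m\<in>UNIV. \<Sum>n\<in>UNIV.
      (\<Sum>a\<in>UNIV. \<Sum>k\<in>UNIV. \<Sum>l\<in>UNIV. V a k l * u $ a * e m $ k * e n $ l) *
      (\<Sum>p\<in>UNIV. \<Sum>q\<in>UNIV. \<Sum>b\<in>UNIV. C p q b * e m $ p * e n $ q * v $ b)) =
    (\<Sum>a\<in>UNIV. \<Sum>b\<in>UNIV. (\<Sum>k\<in>UNIV. \<Sum>l\<in>UNIV. \<Sum>p\<in>UNIV. \<Sum>q\<in>UNIV.
      V a k l * (\<Sum>m\<in>UNIV. e m $ k * e m $ p) * (\<Sum>n\<in>UNIV. e n $ l * e n $ q) * C p q b)
      * u $ a * v $ b)" (is "?L = ?R")
proof -
  let ?f = "\<lambda>m n a k l p q b. V a k l * C p q b * u $ a * v $ b * e m $ k * e m $ p * e n $ l * e n $ q"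
  let ?U = "UNIV :: 3 set"
  have "?L = (\<Sum>m\<in>?U. \<Sum>n\<in>?U. \<Sum>a\<in>?U. \<Sum>k\<in>?U. \<Sum>l\<in>?U. \<Sum>p\<in>?U. \<Sum>q\<in>?U. \<Sum>b\<in>?U. ?f m n a k l p q b)"
    unfolding sum_distrib_right unfolding sum_distrib_left unfolding sum_distrib_right
    by (intro sum.cong refl) (simp only: mult_ac)
  also have "\<dots> = (\<Sum>(m,n,a,k,l,p,q,b)\<in>?U\<times>?U\<times>?U\<times>?U\<times>?U\<times>?U\<times>?U\<times>?U. ?f m n a k l p q b)"
    by (simp only: sum.cartesian_product)
  also have "\<dots> = (\<Sum>(a,b,k,l,p,q,n,m)\<in>?U\<times>?U\<times>?U\<times>?U\<times>?U\<times>?U\<times>?U\<times>?U. ?f m n a k l p q b)"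
    by (rule sum.reindex_bij_witness[of _ "\<lambda>(a,b,k,l,p,q,n,m). (m,n,a,k,l,p,q,b)"
          "\<lambda>(m,n,a,k,l,p,q,b). (a,b,k,l,p,q,n,m)"]) auto
  also have "\<dots> = (\<Sum>a\<in>?U. \<Sum>b\<in>?U. \<Sum>k\<in>?U. \<Sum>l\<in>?U. \<Sum>p\<in>?U. \<Sum>q\<in>?U. \<Sum>n\<in>?U. \<Sum>m\<in>?U. ?f m n a k l p q b)"
    by (simp only: sum.cartesian_product)
  also have "\<dots> = ?R"
    unfolding sum_distrib_right unfolding sum_distrib_left unfolding sum_distrib_right
    by (intro sum.cong refl) (simp only: mult_ac)
  finally show ?thesis .
qed

lemma nabla_at_swap:
  "nabla_at g h x w u v - nabla_at g h x u w v = (\<Sum>p\<in>UNIV. \<Sum>q\<in>UNIV. \<Sum>b\<in>UNIV.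
     (nabla_tensor g h x p q b - nabla_tensor g h x q p b) * w $ p * u $ q * v $ b)"
proof -
  have "nabla_at g h x u w v =
    (\<Sum>p\<in>UNIV. \<Sum>q\<in>UNIV. \<Sum>b\<in>UNIV. nabla_tensor g h x q p b * w $ p * u $ q * v $ b)"
    unfolding nabla_at_def by (subst sum.swap) (simp add: mult_ac)
  then show ?thesis
    by (simp add: nabla_at_def left_diff_distrib sum_subtractf)
qed

lemma dirac_coord_frame:
  assumes "oriented_orthonormal (g x) e"
  shows "bil (dirac_coord g h x) (e i) (e j) = Sym (\<lambda>i j. \<Sum>k\<in>UNIV. \<Sum>l\<in>UNIV.
        volume_form (g x) (e i) (e k) (e l) *
        (nabla_at g h x (e k) (e l) (e j) - nabla_at g h x (e l) (e k) (e j))) i j"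
proof -
  define F where "F a b = (\<Sum>k\<in>UNIV. \<Sum>l\<in>UNIV. \<Sum>p\<in>UNIV. \<Sum>q\<in>UNIV.
        volume_form (g x) (axis a 1) (axis k 1) (axis l 1) * ginv g x $ k $ p * ginv g x $ l $ q *
        (nabla_tensor g h x p q b - nabla_tensor g h x q p b))" for a b
  have F: "(\<Sum>k\<in>UNIV. \<Sum>l\<in>UNIV. volume_form (g x) (e i) (e k) (e l) *
        (nabla_at g h x (e k) (e l) (e j) - nabla_at g h x (e l) (e k) (e j)))
     = (\<Sum>a\<in>UNIV. \<Sum>b\<in>UNIV. F a b * e i $ a * e j $ b)" for i j
    unfolding nabla_at_swap
    by (subst volume_form_expand, subst frame_contraction)
      (simp add: F_def oriented_orthonormal_inverse[OF assms] ginv_def)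
  have "dirac_coord g h x = (\<chi> a b. (1/2) * (F a b + F b a))"
    unfolding dirac_coord_def Sym_def F_def by simp
  then have "bil (dirac_coord g h x) (e i) (e j) =
      (1/2) * ((\<Sum>a\<in>UNIV. \<Sum>b\<in>UNIV. F a b * e i $ a * e j $ b)
        + (\<Sum>a\<in>UNIV. \<Sum>b\<in>UNIV. F b a * e i $ a * e j $ b))"
    by (simp add: bil_def algebra_simps sum.distrib sum_distrib_left)
  also have "(\<Sum>a\<in>UNIV. \<Sum>b\<in>UNIV. F b a * e i $ a * e j $ b)
      = (\<Sum>a\<in>UNIV. \<Sum>b\<in>UNIV. F a b * e j $ a * e i $ b)"
    by (subst sum.swap) (simp add: mult_ac)
  finally show ?thesis by (simp add: Sym_def F)
qed

lemma dirac_eq: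
  assumes "transpose (g x) = g x" "pos_def (g x)"
  shows "dirac g h x = dirac_coord g h x"
proof -
  obtain e where e: "oriented_orthonormal (g x) e"
    using oriented_orthonormal_exists[OF assms] by blast
  show ?thesis
    unfolding dirac_def
  proof (rule the_equality)
    fix D
    assume D: "\<forall>e. oriented_orthonormal (g x) e \<longrightarrow>
     (\<forall>i j. bil D (e i) (e j) = Sym (\<lambda>i j. \<Sum>k\<in>UNIV. \<Sum>l\<in>UNIV.
        volume_form (g x) (e i) (e k) (e l) *
        (nabla_at g h x (e k) (e l) (e j) - nabla_at g h x (e l) (e k) (e j))) i j)"
    show "D = dirac_coord g h x"
      by (rule frame_tensor_unique[OF e]) (use D e dirac_coord_frame[where g = g and x = x, OF e] in simp)
  qed (use dirac_coord_frame in blast)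
qed

lemma dirac_frame:
  assumes "transpose (g x) = g x" "pos_def (g x)" "oriented_orthonormal (g x) e"
  shows "bil (dirac g h x) (e i) (e j) = Sym (\<lambda>i j. \<Sum>k\<in>UNIV. \<Sum>l\<in>UNIV.
        volume_form (g x) (e i) (e k) (e l) *
        (nabla_at g h x (e k) (e l) (e j) - nabla_at g h x (e l) (e k) (e j))) i j"
  using dirac_eq[where g = g and x = x, OF assms(1,2)]
    dirac_coord_frame[where g = g and x = x, OF assms(3)] by simp

end

(* In a chart write \<nabla> for the Levi-Civita connection of g and g_t = g + t h. The difference of the
   Levi-Civita connections of g_t and g is exactly t \<Lambda>_t, where
   (\<Lambda>_t)^k_ij = (1/2) g_t^kl (\<nabla>_i h_jl + \<nabla>_j h_il - \<nabla>_l h_ij), so the curvature tensor of g_t is that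
   of g plus t times an expression that is continuous at t = 0; its value there is the derivative, and
   no space and time derivatives have to be exchanged. Contracting gives
   Ric' = (1/2) (A + A^T - L - T) in terms of the traces A_ab = \<nabla>^p \<nabla>_a h_pb, L_ab = \<nabla>^p \<nabla>_p h_ab and
   T = \<nabla>^2 tr h. With B = \<nabla> \<delta>h, the Ricci identity in constant curvature \<kappa> says
   A = B + 3 \<kappa> h - \<kappa> (tr h) g.
   On the other side, \<epsilon> is parallel, and contracting products of two \<epsilon> expresses the square of the
   Dirac-type operator as 3 (B + B^T) - 4 L - 2 T + 12 \<kappa> h modulo multiples of g. Comparing the
   two expressions, the multiples of g agree because tr A = tr B and tr L = tr T. *)
theory Submission
  imports Defs
begin


section \<open>Partial derivatives\<close>

text \<open>Components are arbitrary off the chart image, and \<open>g + t h\<close> is known to be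
  invertible at a given point only for t near 0, with no bound uniform over the chart. So the
  identities for the varied metric are pointwise, under \<open>det (varied t x) \<noteq> 0\<close>,
  and are differentiated in space for fixed t, near x, on a neighbourhood that may depend on t. The
  limit in t is taken only after the derivative of the inverse metric has been expressed through
  values of the inverse, so that t enters through continuous expressions at one point.
  \<open>dirac\<close> is a description over frames, but its square differentiates it. Hence it is
  replaced on the whole chart by contraction with \<epsilon>, one index down and two up: this form
  contains a single metric factor and 1/sqrt(det g), which makes its parallelism a short
  computation. The 1/8 comes from the normalization of \<open>dirac\<close>: the antisymmetrization
  doubles the curl X of h and \<open>Sym\<close> halves the result, so \<open>dirac\<close> is X +
  X^T, and its square contains -4 L where Ric' contains -L/2. Constant curvature is used at the
  point x alone and is never differentiated.\<close>

lemma partialI: "(f has_derivative f') (at x) \<Longrightarrow> partial k f x = f' (axis k 1)"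
  unfolding partial_def using frechet_derivative_at by metis

lemma has_derivative_frechet:
  "f differentiable (at x) \<Longrightarrow> (f has_derivative frechet_derivative f (at x)) (at x)"
  by (simp add: frechet_derivative_works)

lemma partial_const [simp]: "partial k (\<lambda>y. c) x = 0"
  by (rule partialI[where f' = "\<lambda>_. 0"]) simp

lemma partial_add:
  assumes "f differentiable (at x)" "g differentiable (at x)"
  shows "partial k (\<lambda>y. f y + g y) x = partial k f x + partial k g x"
  using partialI[OF has_derivative_add[OF assms[THEN has_derivative_frechet]], of k]
  by (simp add: partial_def)

lemma partial_diff:
  assumes "f differentiable (at x)" "g differentiable (at x)"
  shows "partial k (\<lambda>y. f y - g y) x = partial k f x - partial k g x"
  using partialI[OF has_derivative_diff[OF assms[THEN has_derivative_frechet]], of k]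
  by (simp add: partial_def)

lemma partial_mult:
  fixes f g :: "real^'n::finite \<Rightarrow> real"
  assumes "f differentiable (at x)" "g differentiable (at x)"
  shows "partial k (\<lambda>y. f y * g y) x = partial k f x * g x + f x * partial k g x"
  using partialI[OF has_derivative_mult[OF assms[THEN has_derivative_frechet]], of k]
  by (simp add: partial_def)

lemma partial_cmult:
  fixes f :: "real^'n::finite \<Rightarrow> real"
  assumes "f differentiable (at x)"
  shows "partial k (\<lambda>y. c * f y) x = c * partial k f x"
  using partial_mult[of "\<lambda>_. c" x f k] assms by simp

lemma partial_sum:
  assumes "\<And>i. i \<in> I \<Longrightarrow> f i differentiable (at x)"
  shows "partial k (\<lambda>y. \<Sum>i\<in>I. f i y) x = (\<Sum>i\<in>I. partial k (f i) x)"
  using partialI[OF has_derivative_sum[of I f "\<lambda>i. frechet_derivative (f i) (at x)" "at x"], of k]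
    assms has_derivative_frechet by (auto simp: partial_def)

lemma partial_linear:
  assumes "bounded_linear L" "f differentiable (at x)"
  shows "partial k (\<lambda>y. L (f y)) x = L (partial k f x)"
  using partialI[OF bounded_linear.has_derivative[OF assms(1) has_derivative_frechet[OF assms(2)]], of k]
  by (simp add: partial_def)

section \<open>Locality of derivatives and of C^k regularity\<close>

lemma has_derivative_cong_nhds:
  assumes "\<forall>\<^sub>F y in nhds x. f y = g y"
  shows "(f has_derivative D) (at x) \<longleftrightarrow> (g has_derivative D) (at x)"
proof -
  have eq: "f x = g x" using assms by (rule eventually_nhds_x_imp_x)
  have ev: "\<forall>\<^sub>F y in at x. f y = g y"
    using assms by (auto simp: eventually_at_filter elim: eventually_mono)
  then have ev': "\<forall>\<^sub>F y in at x. g y = f y" by (auto elim: eventually_mono)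
  show ?thesis
    using has_derivative_transform_eventually[OF _ ev eq UNIV_I]
      has_derivative_transform_eventually[OF _ ev' eq[symmetric] UNIV_I] by blast
qed

lemma partial_cong_ev:
  assumes "\<forall>\<^sub>F y in nhds x. f y = g y"
  shows "partial k f x = partial k g x"
  using has_derivative_cong_nhds[OF assms]
  by (simp add: partial_def frechet_derivative_def)

lemma differentiable_cong_ev:
  assumes "\<forall>\<^sub>F y in nhds x. f y = g y"
  shows "f differentiable (at x) \<longleftrightarrow> g differentiable (at x)"
  using has_derivative_cong_nhds[OF assms]
  by (simp add: differentiable_def)

lemma eventually_eq_open:
  assumes "open S" "x \<in> S" "\<And>y. y \<in> S \<Longrightarrow> f y = g y"
  shows "\<forall>\<^sub>F y in nhds x. f y = g y"
  using assms by (meson eventually_nhds)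

lemma C_k_on_cong:
  assumes "open S" "\<And>y. y \<in> S \<Longrightarrow> f y = g y"
  shows "C_k_on k S f \<longleftrightarrow> C_k_on k S g"
  using assms(2)
proof (induction k arbitrary: f g)
  case 0
  then show ?case by (simp cong: continuous_on_cong)
next
  case (Suc k)
  have "partial i f y = partial i g y" if "y \<in> S" for y i
    by (rule partial_cong_ev[OF eventually_eq_open[OF assms(1) that Suc.prems]])
  moreover have "f differentiable (at y) \<longleftrightarrow> g differentiable (at y)" if "y \<in> S" for y
    by (rule differentiable_cong_ev[OF eventually_eq_open[OF assms(1) that Suc.prems]])
  ultimately show ?case using Suc.IH[of "partial _ f" "partial _ g"] by simp
qed

lemma C_k_on_linear:
  assumes "open S" "bounded_linear L" "C_k_on k S f"
  shows "C_k_on k S (\<lambda>y. L (f y))"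
  using assms(3)
proof (induction k arbitrary: f)
  case 0
  then show ?case using bounded_linear.continuous_on[OF assms(2)] by simp
next
  case (Suc k)
  have "C_k_on k S (partial i (\<lambda>y. L (f y)))" for i
  proof -
    have "C_k_on k S (\<lambda>y. L (partial i f y))" using Suc by simp
    moreover have "partial i (\<lambda>y. L (f y)) y = L (partial i f y)" if "y \<in> S" for y
      using Suc.prems that partial_linear[OF assms(2)] by auto
    ultimately show ?thesis
      using C_k_on_cong[OF assms(1), of "partial i (\<lambda>y. L (f y))" "\<lambda>y. L (partial i f y)"] by blast
  qed
  moreover have "(\<lambda>y. L (f y)) differentiable (at y)" if "y \<in> S" for y
    using Suc.prems that bounded_linear.has_derivative[OF assms(2)]
    unfolding differentiable_def by (metis C_k_on.simps(2) differentiable_def)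
  ultimately show ?case by simp
qed

section \<open>Symmetry of second partial derivatives\<close>

lemma partial_line_deriv:
  fixes f :: "real^'n::finite \<Rightarrow> real"
  assumes "f differentiable (at (p + s *\<^sub>R axis i 1))"
  shows "((\<lambda>s. f (p + s *\<^sub>R axis i 1)) has_real_derivative partial i f (p + s *\<^sub>R axis i 1)) (at s)"
proof -
  let ?D = "frechet_derivative f (at (p + s *\<^sub>R axis i 1))"
  have D: "(f has_derivative ?D) (at (p + s *\<^sub>R axis i 1))"
    using assms by (rule has_derivative_frechet)
  have "((\<lambda>s. p + s *\<^sub>R axis i 1) has_derivative (\<lambda>d. d *\<^sub>R axis i 1)) (at s)"
    by (auto intro!: derivative_eq_intros)
  from has_derivative_compose[OF this D]
  have "((\<lambda>s. f (p + s *\<^sub>R axis i 1)) has_derivative (\<lambda>d. ?D (d *\<^sub>R axis i 1))) (at s)" .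
  moreover have "?D (d *\<^sub>R axis i 1) = partial i f (p + s *\<^sub>R axis i 1) * d" for d
    using linear_scale[OF has_derivative_linear[OF D]] by (simp add: partial_def)
  ultimately show ?thesis by (simp add: has_field_derivative_def)
qed

text \<open>The mean value theorem is applied to the difference of f along two parallel sides, then
  to \<open>partial i f\<close> along the other direction. The left side is symmetric in i and j
  while the right side is not, and this is what makes the two orders of differentiation
  comparable.\<close>

lemma double_difference_mvt:
  fixes f :: "real^'n::finite \<Rightarrow> real"
  assumes "0 < r"
    and f: "\<And>s t. 0 \<le> s \<Longrightarrow> s \<le> r \<Longrightarrow> 0 \<le> t \<Longrightarrow> t \<le> r \<Longrightarrow> f differentiable (at (x + s *\<^sub>R axis i 1 + t *\<^sub>R axis j 1))"
    and fi: "\<And>s t. 0 \<le> s \<Longrightarrow> s \<le> r \<Longrightarrow> 0 \<le> t \<Longrightarrow> t \<le> r \<Longrightarrow> partial i f differentiable (at (x + s *\<^sub>R axis i 1 + t *\<^sub>R axis j 1))"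
  shows "\<exists>s t. 0 \<le> s \<and> s \<le> r \<and> 0 \<le> t \<and> t \<le> r \<and>
    f (x + r *\<^sub>R axis i 1 + r *\<^sub>R axis j 1) - f (x + r *\<^sub>R axis i 1) - f (x + r *\<^sub>R axis j 1) + f x
      = r\<^sup>2 * partial j (partial i f) (x + s *\<^sub>R axis i 1 + t *\<^sub>R axis j 1)"
proof -
  let ?d = "\<lambda>s. f ((x + r *\<^sub>R axis j 1) + s *\<^sub>R axis i 1) - f (x + s *\<^sub>R axis i 1)"
  let ?d' = "\<lambda>s. partial i f ((x + r *\<^sub>R axis j 1) + s *\<^sub>R axis i 1) - partial i f (x + s *\<^sub>R axis i 1)"
  have "\<And>s. 0 \<le> s \<Longrightarrow> s \<le> r \<Longrightarrow> DERIV ?d s :> ?d' s"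
  proof (intro DERIV_diff partial_line_deriv)
    fix s assume s: "0 \<le> s" "s \<le> r"
    show "f differentiable (at (x + r *\<^sub>R axis j 1 + s *\<^sub>R axis i 1))"
      using f[OF s, of r] assms(1) by (simp add: ac_simps)
    show "f differentiable (at (x + s *\<^sub>R axis i 1))"
      using f[OF s, of 0] assms(1) by simp
  qed
  from MVT2[OF assms(1) this] obtain s where s: "0 < s" "s < r" "?d r - ?d 0 = r * ?d' s" by auto
  let ?p = "x + s *\<^sub>R axis i 1"
  have "\<And>t. 0 \<le> t \<Longrightarrow> t \<le> r \<Longrightarrow> DERIV (\<lambda>t. partial i f (?p + t *\<^sub>R axis j 1)) t :>
      partial j (partial i f) (?p + t *\<^sub>R axis j 1)"
    using fi s by (intro partial_line_deriv) auto
  from MVT2[OF assms(1) this] obtain t where t: "0 < t" "t < r"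
    "partial i f (?p + r *\<^sub>R axis j 1) - partial i f ?p = r * partial j (partial i f) (?p + t *\<^sub>R axis j 1)"
    by auto
  have "?d r - ?d 0 = r\<^sup>2 * partial j (partial i f) (?p + t *\<^sub>R axis j 1)"
    using s(3) t(3) by (simp add: ac_simps power2_eq_square)
  then show ?thesis using s t
    by (intro exI[of _ s] exI[of _ t]) (simp add: algebra_simps)
qed

lemma partial_commute:
  fixes f :: "real^'n::finite \<Rightarrow> real"
  assumes "open S" "x \<in> S" "C_k_on 2 S f"
  shows "partial i (partial j f) x = partial j (partial i f) x"
proof (rule ccontr)
  let ?a = "partial i (partial j f)" and ?b = "partial j (partial i f)"
  assume "?a x \<noteq> ?b x"
  define e where "e = dist (?a x) (?b x) / 2"
  have e: "e > 0" using \<open>?a x \<noteq> ?b x\<close> by (simp add: e_def)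
  have C: "f differentiable (at y)" "partial k f differentiable (at y)"
    "continuous_on S (partial l (partial k f))" if "y \<in> S" for y k l
    using assms(3) that by (auto simp: numeral_2_eq_2)
  have "continuous (at x) ?a" "continuous (at x) ?b"
    using C(3)[OF assms(2)] assms(1,2) by (auto simp: continuous_on_eq_continuous_at)
  then obtain d1 d2 where d: "d1 > 0" "d2 > 0"
    "\<And>y. dist y x < d1 \<Longrightarrow> dist (?a y) (?a x) < e"
    "\<And>y. dist y x < d2 \<Longrightarrow> dist (?b y) (?b x) < e"
    using e unfolding continuous_at_eps_delta by metis
  obtain d0 where d0: "d0 > 0" "ball x d0 \<subseteq> S"
    using assms(1,2) open_contains_ball by blast
  \<comment> \<open>Points of the square of side r lie within 2r of its corner x, so a third of the
    radii keeps them strictly inside all three balls.\<close>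
  define r where "r = min d0 (min d1 d2) / 3"
  have r: "r > 0" "3 * r \<le> d0" "3 * r \<le> d1" "3 * r \<le> d2"
    using d d0 by (auto simp: r_def)
  have near: "dist (x + s *\<^sub>R axis k 1 + t *\<^sub>R axis l 1) x < 3 * r"
    if "0 \<le> s" "s \<le> r" "0 \<le> t" "t \<le> r" for s t :: real and k l :: 'n
  proof -
    have "dist (x + s *\<^sub>R axis k 1 + t *\<^sub>R axis l 1) x \<le> norm (s *\<^sub>R axis k (1::real)) + norm (t *\<^sub>R axis l (1::real))"
      using norm_triangle_ineq[of "s *\<^sub>R axis k (1::real)" "t *\<^sub>R axis l 1"]
      by (simp add: dist_norm add.assoc)
    also have "\<dots> = s + t" using that by simp
    finally show ?thesis using that r(1) by linarith
  qed
  have inS: "x + s *\<^sub>R axis k 1 + t *\<^sub>R axis l 1 \<in> S"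
    if "0 \<le> s" "s \<le> r" "0 \<le> t" "t \<le> r" for s t :: real and k l :: 'n
    using near[OF that, of k l] d0(2) r(2) by (auto simp: dist_commute subset_iff)
  obtain s t where st: "0 \<le> s" "s \<le> r" "0 \<le> t" "t \<le> r"
    "f (x + r *\<^sub>R axis i 1 + r *\<^sub>R axis j 1) - f (x + r *\<^sub>R axis i 1) - f (x + r *\<^sub>R axis j 1) + f x
      = r\<^sup>2 * ?b (x + s *\<^sub>R axis i 1 + t *\<^sub>R axis j 1)"
    using double_difference_mvt[OF r(1) C(1)[OF inS] C(2)[OF inS], of i j] by auto
  obtain s' t' where st': "0 \<le> s'" "s' \<le> r" "0 \<le> t'" "t' \<le> r"
    "f (x + r *\<^sub>R axis j 1 + r *\<^sub>R axis i 1) - f (x + r *\<^sub>R axis j 1) - f (x + r *\<^sub>R axis i 1) + f x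
      = r\<^sup>2 * ?a (x + s' *\<^sub>R axis j 1 + t' *\<^sub>R axis i 1)"
    using double_difference_mvt[OF r(1) C(1)[OF inS] C(2)[OF inS], of j i] by auto
  have pp: "x + r *\<^sub>R axis i 1 + r *\<^sub>R axis j 1 = x + r *\<^sub>R axis j 1 + r *\<^sub>R axis i (1::real)"
    by (simp add: ac_simps)
  have "r\<^sup>2 * ?a (x + s' *\<^sub>R axis j 1 + t' *\<^sub>R axis i 1) = r\<^sup>2 * ?b (x + s *\<^sub>R axis i 1 + t *\<^sub>R axis j 1)"
    using st(5) st'(5) unfolding pp by linarith
  then have "?a (x + s' *\<^sub>R axis j 1 + t' *\<^sub>R axis i 1) = ?b (x + s *\<^sub>R axis i 1 + t *\<^sub>R axis j 1)"
    using r(1) by simp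
  moreover have "dist (?a (x + s' *\<^sub>R axis j 1 + t' *\<^sub>R axis i 1)) (?a x) < e"
    by (rule d(3)) (rule less_le_trans[OF near[OF st'(1-4)] r(3)])
  moreover have "dist (?b (x + s *\<^sub>R axis i 1 + t *\<^sub>R axis j 1)) (?b x) < e"
    by (rule d(4)) (rule less_le_trans[OF near[OF st(1-4)] r(4)])
  ultimately have "dist (?a x) (?b x) < 2 * e"
    using dist_triangle2[of "?a x" "?b x" "?a (x + s' *\<^sub>R axis j 1 + t' *\<^sub>R axis i 1)"]
    by (simp add: dist_commute)
  then show False by (simp add: e_def)
qed


section \<open>Inverse matrices\<close>

text \<open>Case distinction on indices produces sums such as 2 + 2 in the type \<open>3\<close>;
  these facts reduce them modulo 3.\<close>

lemma arith_3: "(3::3) = 0" "(4::3) = 1" "(5::3) = 2"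
  by simp_all

text \<open>The indices are cyclic: arithmetic in the type \<open>3\<close> is modulo 3, so no signs appear in the cofactors.\<close>
definition adj3 :: "real^3^3 \<Rightarrow> 3 \<Rightarrow> 3 \<Rightarrow> real" where
  "adj3 A i j = A $ (j + 1) $ (i + 1) * A $ (j + 2) $ (i + 2) - A $ (j + 1) $ (i + 2) * A $ (j + 2) $ (i + 1)"

lemma matrix_inv_mult:
  fixes A :: "real^'n::finite^'n"
  assumes "det A \<noteq> 0"
  shows "A ** matrix_inv A = mat 1" "matrix_inv A ** A = mat 1"
proof -
  have "\<exists>B. A ** B = mat 1 \<and> B ** A = mat 1"
    using assms by (simp add: invertible_det_nz[symmetric] invertible_def)
  then have "A ** matrix_inv A = mat 1 \<and> matrix_inv A ** A = mat 1"
    unfolding matrix_inv_def by (rule someI_ex)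
  then show "A ** matrix_inv A = mat 1" "matrix_inv A ** A = mat 1" by auto
qed

lemma matrix_inv_sum:
  fixes A :: "real^'n::finite^'n"
  assumes "det A \<noteq> 0"
  shows "(\<Sum>k\<in>UNIV. A $ i $ k * matrix_inv A $ k $ j) = (if i = j then 1 else 0)"
    "(\<Sum>k\<in>UNIV. matrix_inv A $ i $ k * A $ k $ j) = (if i = j then 1 else 0)"
  using matrix_inv_mult[OF assms, THEN arg_cong[where f = "\<lambda>M. M $ i $ j"]]
  by (simp_all add: matrix_matrix_mult_def mat_def)

text \<open>Cramer's rule: the product of A with its adjugate is checked entry by entry, then A is
  cancelled from the left. It makes the inverse a rational function of the entries, which settles
  both its limits and its differentiability.\<close>

lemma matrix_inv_3:
  assumes "det A \<noteq> 0"
  shows "matrix_inv A $ i $ j = adj3 A i j / det A"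
proof -
  have adj: "(\<Sum>k\<in>UNIV. A $ l $ k * adj3 A k j) = (if l = j then det A else 0)" for l
    using exhaust_3[of l] exhaust_3[of j] by (elim disjE) (simp_all add: arith_3 sum_3 adj3_def det_3 algebra_simps)
  have "adj3 A i j = (\<Sum>k\<in>UNIV. (if i = k then 1 else 0) * adj3 A k j)"
    by (simp add: mult_delta_left)
  also have "\<dots> = (\<Sum>k\<in>UNIV. \<Sum>l\<in>UNIV. matrix_inv A $ i $ l * (A $ l $ k * adj3 A k j))"
    by (simp only: matrix_inv_sum(2)[OF assms, symmetric] sum_distrib_right mult.assoc)
  also have "\<dots> = (\<Sum>l\<in>UNIV. matrix_inv A $ i $ l * (\<Sum>k\<in>UNIV. A $ l $ k * adj3 A k j))"
    by (subst sum.swap) (simp only: sum_distrib_left)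
  also have "\<dots> = matrix_inv A $ i $ j * det A"
    by (simp add: adj if_distrib cong: if_cong)
  finally show ?thesis using assms by simp
qed

lemma matrix_inv_symmetric:
  fixes A :: "real^3^3"
  assumes "det A \<noteq> 0" "\<And>i j. A $ i $ j = A $ j $ i"
  shows "matrix_inv A $ i $ j = matrix_inv A $ j $ i"
  unfolding matrix_inv_3[OF assms(1)] adj3_def
  by (simp add: assms(2)[of "i + _" "j + _"] mult.commute)

section \<open>Limits and derivatives of the inverse matrix\<close>

lemma tendsto_det_3:
  fixes A :: "'b \<Rightarrow> real^3^3"
  assumes "\<And>i j. ((\<lambda>t. A t $ i $ j) \<longlongrightarrow> L $ i $ j) F"
  shows "((\<lambda>t. det (A t)) \<longlongrightarrow> det L) F"
  unfolding det_3 by (intro assms tendsto_add tendsto_diff tendsto_mult)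

lemma tendsto_matrix_inv_3:
  fixes A :: "'b \<Rightarrow> real^3^3"
  assumes "\<And>i j. ((\<lambda>t. A t $ i $ j) \<longlongrightarrow> L $ i $ j) F" "det L \<noteq> 0"
  shows "((\<lambda>t. matrix_inv (A t) $ i $ j) \<longlongrightarrow> matrix_inv L $ i $ j) F"
proof -
  have d: "((\<lambda>t. det (A t)) \<longlongrightarrow> det L) F" by (rule tendsto_det_3[OF assms(1)])
  have "\<forall>\<^sub>F t in F. det (A t) \<noteq> 0" by (rule tendsto_imp_eventually_ne[OF d assms(2)])
  then have "\<forall>\<^sub>F t in F. adj3 (A t) i j / det (A t) = matrix_inv (A t) $ i $ j"
    by eventually_elim (simp add: matrix_inv_3)
  moreover have "((\<lambda>t. adj3 (A t) i j / det (A t)) \<longlongrightarrow> adj3 L i j / det L) F"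
    unfolding adj3_def by (intro assms d tendsto_divide tendsto_diff tendsto_mult)
  ultimately show ?thesis
    unfolding matrix_inv_3[OF assms(2)] by (rule Lim_transform_eventually[rotated])
qed

lemma differentiable_det_3:
  fixes A :: "real^'n::finite \<Rightarrow> real^3^3"
  assumes "\<And>i j. (\<lambda>y. A y $ i $ j) differentiable (at x)"
  shows "(\<lambda>y. det (A y)) differentiable (at x)"
  unfolding det_3 by (intro assms differentiable_add differentiable_diff differentiable_mult)

lemma eventually_det_nz:
  fixes A :: "real^'n::finite \<Rightarrow> real^3^3"
  assumes "\<And>i j. (\<lambda>y. A y $ i $ j) differentiable (at x)" "det (A x) \<noteq> 0"
  shows "\<forall>\<^sub>F y in nhds x. det (A y) \<noteq> 0"
proof -
  have "isCont (\<lambda>y. det (A y)) x"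
    by (rule differentiable_imp_continuous_within[OF differentiable_det_3[OF assms(1)]])
  then have "((\<lambda>y. det (A y)) \<longlongrightarrow> det (A x)) (nhds x)"
    unfolding isCont_def by (rule iffD1[OF tendsto_at_iff_tendsto_nhds])
  then show ?thesis by (rule tendsto_imp_eventually_ne[OF _ assms(2)])
qed

lemma differentiable_matrix_inv_3:
  fixes A :: "real^'n::finite \<Rightarrow> real^3^3"
  assumes "\<And>i j. (\<lambda>y. A y $ i $ j) differentiable (at x)" "det (A x) \<noteq> 0"
  shows "(\<lambda>y. matrix_inv (A y) $ i $ j) differentiable (at x)"
proof -
  have "\<forall>\<^sub>F y in nhds x. matrix_inv (A y) $ i $ j = adj3 (A y) i j / det (A y)"
    using eventually_det_nz[OF assms] by eventually_elim (simp add: matrix_inv_3)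
  moreover have "(\<lambda>y. adj3 (A y) i j / det (A y)) differentiable (at x)"
    unfolding adj3_def
    by (intro assms differentiable_det_3 differentiable_divide differentiable_diff differentiable_mult)
  ultimately show ?thesis by (simp only: differentiable_cong_ev)
qed

lemma partial_matrix_inv_3:
  fixes A :: "real^'n::finite \<Rightarrow> real^3^3"
  assumes A: "\<And>i j. (\<lambda>y. A y $ i $ j) differentiable (at x)" and nz: "det (A x) \<noteq> 0"
  shows "partial k (\<lambda>y. matrix_inv (A y) $ i $ j) x =
    - (\<Sum>m\<in>UNIV. \<Sum>n\<in>UNIV. matrix_inv (A x) $ i $ m * partial k (\<lambda>y. A y $ m $ n) x * matrix_inv (A x) $ n $ j)"
proof -
  note P = differentiable_matrix_inv_3[OF A nz]
  let ?P = "\<lambda>i j y. matrix_inv (A y) $ i $ j"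
  \<comment> \<open>The product of A and its inverse is constant near x, where the determinant stays
    nonzero; the product rule for this constant determines the derivative of the inverse after
    multiplication by the inverse on the left.\<close>
  have *: "(\<Sum>m\<in>UNIV. A x $ l $ m * partial k (?P m j) x) = - (\<Sum>m\<in>UNIV. partial k (\<lambda>y. A y $ l $ m) x * ?P m j x)" for l
  proof -
    have "partial k (\<lambda>y. \<Sum>m\<in>UNIV. A y $ l $ m * ?P m j y) x = partial k (\<lambda>y. if l = j then 1 else 0) x"
      by (rule partial_cong_ev) (use eventually_det_nz[OF A nz] in \<open>auto simp: matrix_inv_sum elim: eventually_mono\<close>)
    moreover have "partial k (\<lambda>y. \<Sum>m\<in>UNIV. A y $ l $ m * ?P m j y) x =
       (\<Sum>m\<in>UNIV. partial k (\<lambda>y. A y $ l $ m) x * ?P m j x + A x $ l $ m * partial k (?P m j) x)"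
      by (simp add: partial_sum partial_mult A P)
    ultimately show ?thesis by (simp add: sum.distrib)
  qed
  have "partial k (?P i j) x = (\<Sum>m\<in>UNIV. (if i = m then 1 else 0) * partial k (?P m j) x)"
    by (simp add: mult_delta_left)
  also have "\<dots> = (\<Sum>m\<in>UNIV. \<Sum>l\<in>UNIV. ?P i l x * (A x $ l $ m * partial k (?P m j) x))"
    by (simp only: matrix_inv_sum(2)[OF nz, symmetric] sum_distrib_right mult.assoc)
  also have "\<dots> = (\<Sum>l\<in>UNIV. ?P i l x * (\<Sum>m\<in>UNIV. A x $ l $ m * partial k (?P m j) x))"
    by (subst sum.swap) (simp only: sum_distrib_left)
  also have "\<dots> = - (\<Sum>l\<in>UNIV. \<Sum>m\<in>UNIV. ?P i l x * partial k (\<lambda>y. A y $ l $ m) x * ?P m j x)"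
    unfolding * by (simp add: sum_distrib_left sum_negf mult.assoc)
  finally show ?thesis .
qed

text \<open>An orthonormal frame M gives M G M^T = 1, so det G is the inverse of a square.\<close>

lemma pos_def_det_pos:
  assumes "\<And>i j. G $ i $ j = G $ j $ i" "pos_def G"
  shows "det G > 0"
proof -
  have "transpose G = G" using assms(1) by (simp add: transpose_def vec_eq_iff)
  then obtain e where e: "oriented_orthonormal G e"
    using oriented_orthonormal_exists[OF _ assms(2)] by blast
  have "(\<chi> i. e i) ** G ** transpose (\<chi> i. e i) = mat 1"
    unfolding bil_matrix[symmetric] using e by (simp add: oriented_orthonormal_def mat_def vec_eq_iff)
  then have "det ((\<chi> i. e i) ** G ** transpose (\<chi> i. e i)) = 1" by simp
  then have "(det (\<chi> i. e i))\<^sup>2 * det G = 1"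
    by (simp add: det_mul power2_eq_square mult_ac)
  then have "0 < (det (\<chi> i. e i))\<^sup>2 * det G" by simp
  then show ?thesis by (auto simp: zero_less_mult_iff)
qed


section \<open>The Levi-Civita connection\<close>

lemma sum_delta_mult:
  fixes f :: "'i::finite \<Rightarrow> real"
  shows "(\<Sum>i\<in>UNIV. (if i = j then 1 else 0) * f i) = f j" "(\<Sum>i\<in>UNIV. (if j = i then 1 else 0) * f i) = f j"
    "(\<Sum>i\<in>UNIV. f i * (if i = j then 1 else 0)) = f j" "(\<Sum>i\<in>UNIV. f i * (if j = i then 1 else 0)) = f j"
  by (simp_all add: mult_delta_left mult_delta_right)

lemma contract_inverse:
  fixes G Q :: "'i::finite \<Rightarrow> 'i \<Rightarrow> real"
  assumes "\<And>a j. (\<Sum>n\<in>UNIV. G a n * Q n j) = (if a = j then 1 else 0)"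
  shows "(\<Sum>n\<in>UNIV. (\<Sum>a\<in>UNIV. f a * G a n) * Q n j) = f j"
proof -
  have "(\<Sum>n\<in>UNIV. (\<Sum>a\<in>UNIV. f a * G a n) * Q n j) = (\<Sum>a\<in>UNIV. f a * (\<Sum>n\<in>UNIV. G a n * Q n j))"
    unfolding sum_distrib_right sum_distrib_left by (subst sum.swap) (simp only: mult_ac)
  then show ?thesis by (simp only: assms sum_delta_mult)
qed

text \<open>\<open>nabla3 g T x k a b c\<close> is $\nabla_kT_{abc}$.\<close>
definition nabla3 :: "tensor_comp \<Rightarrow> (real^3 \<Rightarrow> 3 \<Rightarrow> 3 \<Rightarrow> 3 \<Rightarrow> real) \<Rightarrow> real^3 \<Rightarrow> 3 \<Rightarrow> 3 \<Rightarrow> 3 \<Rightarrow> 3 \<Rightarrow> real" where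
  "nabla3 g T x k a b c = partial k (\<lambda>y. T y a b c) x
     - (\<Sum>m\<in>UNIV. christoffel g x m k a * T x m b c)
     - (\<Sum>m\<in>UNIV. christoffel g x m k b * T x a m c)
     - (\<Sum>m\<in>UNIV. christoffel g x m k c * T x a b m)"

text \<open>The formula is local, so one chart is isolated. Order two is the highest order of
  derivatives of the metric in the curvature; symmetry is stated by entries because it is used for
  rewriting single terms.\<close>

locale riemannian_chart =
  fixes S :: "(real^3) set" and g :: tensor_comp
  assumes open_S: "open S"
    and smooth: "\<And>i j. C_k_on 2 S (\<lambda>y. g y $ i $ j)"
    and sym: "\<And>y i j. y \<in> S \<Longrightarrow> g y $ i $ j = g y $ j $ i"
    and pos: "\<And>y. y \<in> S \<Longrightarrow> pos_def (g y)"
begin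

lemma partial_cong_S:
  assumes "x \<in> S" "\<And>y. y \<in> S \<Longrightarrow> f y = f' y"
  shows "partial k f x = partial k f' x"
  using partial_cong_ev[OF eventually_eq_open[OF open_S assms]] .

lemma C2_differentiable:
  assumes "C_k_on 2 S f" "x \<in> S"
  shows "f differentiable (at x)" "partial k f differentiable (at x)"
  using assms by (auto simp: numeral_2_eq_2)

lemmas g_diff = C2_differentiable[OF smooth]

lemma det_pos: "x \<in> S \<Longrightarrow> det (g x) > 0"
  by (intro pos_def_det_pos sym pos)

lemma det_nz: "x \<in> S \<Longrightarrow> det (g x) \<noteq> 0"
  using det_pos by force

lemma ginv_diff: "x \<in> S \<Longrightarrow> (\<lambda>y. ginv g y $ i $ j) differentiable (at x)"
  unfolding ginv_def by (intro differentiable_matrix_inv_3 g_diff det_nz)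

lemma ginv_sym: "x \<in> S \<Longrightarrow> ginv g x $ i $ j = ginv g x $ j $ i"
  unfolding ginv_def by (intro matrix_inv_symmetric sym det_nz)

lemma ginv_sum:
  assumes "x \<in> S"
  shows "(\<Sum>k\<in>UNIV. g x $ i $ k * ginv g x $ k $ j) = (if i = j then 1 else 0)"
    "(\<Sum>k\<in>UNIV. ginv g x $ i $ k * g x $ k $ j) = (if i = j then 1 else 0)"
  using matrix_inv_sum[OF det_nz[OF assms]] by (simp_all add: ginv_def)

section \<open>Christoffel symbols and compatibility with the metric\<close>

lemma partial_g_sym:
  "x \<in> S \<Longrightarrow> partial k (\<lambda>y. g y $ i $ j) x = partial k (\<lambda>y. g y $ j $ i) x"
  by (rule partial_cong_S) (auto intro: sym)

lemma christoffel_sym: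
  "x \<in> S \<Longrightarrow> christoffel g x k i j = christoffel g x k j i"
  unfolding christoffel_def by (simp add: partial_g_sym[of x _ i j] algebra_simps)

lemma christoffel_diff: "x \<in> S \<Longrightarrow> (\<lambda>y. christoffel g y k i j) differentiable (at x)"
  unfolding christoffel_def
  by (intro differentiable_mult differentiable_const differentiable_sum ballI finite
      differentiable_add differentiable_diff ginv_diff g_diff)

lemma christoffel_lower:
  assumes "x \<in> S"
  shows "(\<Sum>k\<in>UNIV. g x $ l $ k * christoffel g x k i j) =
    (partial i (\<lambda>y. g y $ j $ l) x + partial j (\<lambda>y. g y $ i $ l) x - partial l (\<lambda>y. g y $ i $ j) x) / 2"
proof -
  let ?C = "\<lambda>l. partial i (\<lambda>y. g y $ j $ l) x + partial j (\<lambda>y. g y $ i $ l) x - partial l (\<lambda>y. g y $ i $ j) x"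
  have "(\<Sum>k\<in>UNIV. g x $ l $ k * christoffel g x k i j)
      = (\<Sum>k\<in>UNIV. (\<Sum>m\<in>UNIV. ?C m * ginv g x $ m $ k) * g x $ k $ l) / 2"
    unfolding christoffel_def
    using ginv_sym[OF assms] sym[OF assms]
    by (simp add: sum_divide_distrib sum_distrib_left sum_distrib_right mult_ac)
  also have "\<dots> = ?C l / 2"
    by (simp add: contract_inverse[OF ginv_sum(2)[OF assms]])
  finally show ?thesis .
qed

text \<open>Metric compatibility: in the sum of the two lowered symbols the derivatives of g in the
  directions i and j cancel. As a rewrite rule it removes all derivatives of the metric in favour of
  Christoffel symbols.\<close>

lemma partial_g:
  assumes "x \<in> S"
  shows "partial k (\<lambda>y. g y $ i $ j) x =
    (\<Sum>m\<in>UNIV. christoffel g x m k i * g x $ m $ j) + (\<Sum>m\<in>UNIV. christoffel g x m k j * g x $ i $ m)"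
proof -
  have "(\<Sum>m\<in>UNIV. christoffel g x m k i * g x $ m $ j) = (\<Sum>m\<in>UNIV. g x $ j $ m * christoffel g x m k i)"
    "(\<Sum>m\<in>UNIV. christoffel g x m k j * g x $ i $ m) = (\<Sum>m\<in>UNIV. g x $ i $ m * christoffel g x m k j)"
    by (simp_all add: sym[OF assms, of _ j] mult.commute)
  then show ?thesis
    unfolding christoffel_lower[OF assms]
    using partial_g_sym[OF assms] by (simp add: field_simps)
qed

text \<open>Parallelism of the inverse metric. Compatibility is inserted into the derivative of the
  inverse matrix, and in each of the two resulting terms g absorbs one of the two inverses.\<close>

lemma partial_ginv:
  assumes "x \<in> S"
  shows "partial k (\<lambda>y. ginv g y $ i $ j) x =
    - (\<Sum>m\<in>UNIV. christoffel g x i k m * ginv g x $ m $ j) - (\<Sum>m\<in>UNIV. christoffel g x j k m * ginv g x $ i $ m)"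
proof -
  let ?P = "\<lambda>i j. ginv g x $ i $ j" and ?c = "\<lambda>a i. christoffel g x a k i"
  have split: "(\<Sum>m\<in>UNIV. \<Sum>n\<in>UNIV. p m * (X m n + Y n m) * q n) =
      (\<Sum>m\<in>UNIV. p m * (\<Sum>n\<in>UNIV. X m n * q n)) + (\<Sum>n\<in>UNIV. (\<Sum>m\<in>UNIV. Y n m * p m) * q n)"
    for p q :: "3 \<Rightarrow> real" and X Y
    by (simp add: sum_3 algebra_simps)
  have "partial k (\<lambda>y. ginv g y $ i $ j) x = - (\<Sum>m\<in>UNIV. \<Sum>n\<in>UNIV. ?P i m *
      ((\<Sum>a\<in>UNIV. ?c a m * g x $ a $ n) + (\<Sum>a\<in>UNIV. ?c a n * g x $ m $ a)) * ?P n j)"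
    unfolding ginv_def partial_matrix_inv_3[OF g_diff(1)[OF assms] det_nz[OF assms]]
    by (simp only: partial_g[OF assms])
  also have "\<dots> = - (\<Sum>m\<in>UNIV. \<Sum>n\<in>UNIV. ?P i m *
      ((\<Sum>a\<in>UNIV. ?c a m * g x $ a $ n) + (\<Sum>a\<in>UNIV. ?c a n * g x $ a $ m)) * ?P n j)"
  proof -
    have "(\<Sum>a\<in>UNIV. ?c a n * g x $ m $ a) = (\<Sum>a\<in>UNIV. ?c a n * g x $ a $ m)" for m n
      by (rule sum.cong) (simp_all add: sym[OF assms, of m])
    then show ?thesis by (simp only:)
  qed
  also have "\<dots> = - (\<Sum>m\<in>UNIV. ?P i m * (\<Sum>n\<in>UNIV. (\<Sum>a\<in>UNIV. ?c a m * g x $ a $ n) * ?P n j))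
      - (\<Sum>n\<in>UNIV. (\<Sum>m\<in>UNIV. (\<Sum>a\<in>UNIV. ?c a n * g x $ a $ m) * ?P i m) * ?P n j)"
    unfolding split by simp
  also have "\<dots> = - (\<Sum>m\<in>UNIV. ?P i m * (\<Sum>n\<in>UNIV. (\<Sum>a\<in>UNIV. ?c a m * g x $ a $ n) * ?P n j))
      - (\<Sum>n\<in>UNIV. (\<Sum>m\<in>UNIV. (\<Sum>a\<in>UNIV. ?c a n * g x $ a $ m) * ?P m i) * ?P n j)"
    by (simp only: ginv_sym[OF assms, of i])
  also have "\<dots> = - (\<Sum>m\<in>UNIV. ?P i m * ?c j m) - (\<Sum>n\<in>UNIV. ?c i n * ?P n j)"
    by (simp add: contract_inverse[OF ginv_sum(1)[OF assms]])
  finally show ?thesis by (simp add: mult.commute)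
qed

text \<open>Jacobi's formula: the logarithmic derivative of det g is the trace of g^-1 times the
  derivative of g, which compatibility turns into twice the trace of the Christoffel
  symbols.\<close>

lemma partial_det:
  assumes "x \<in> S"
  shows "partial k (\<lambda>y. det (g y)) x = 2 * (\<Sum>m\<in>UNIV. christoffel g x m k m) * det (g x)"
proof -
  note d = differentiable_add differentiable_diff differentiable_mult g_diff(1)[OF assms]
  have *: "partial k (\<lambda>y. a y * b y * c y) x = partial k a x * b x * c x + a x * partial k b x * c x + a x * b x * partial k c x"
    if "a differentiable (at x)" "b differentiable (at x)" "c differentiable (at x)" for a b c :: "real^3 \<Rightarrow> real"
    using that by (simp add: partial_mult differentiable_mult algebra_simps)
  show ?thesis
    by (simp only: det_3 partial_add partial_diff * d)
      (simp add: partial_g[OF assms] sum_3 algebra_simps)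
qed

section \<open>Covariant derivatives of contractions and the Ricci identity\<close>

lemma nabla_tensor_diff:
  assumes "x \<in> S" "\<And>i j. C_k_on 2 S (\<lambda>y. h y $ i $ j)"
  shows "(\<lambda>y. nabla_tensor g h y k i j) differentiable (at x)"
  unfolding nabla_tensor_def
  by (intro differentiable_mult differentiable_const differentiable_sum ballI finite
      differentiable_add differentiable_diff christoffel_diff C2_differentiable[OF assms(2)] assms(1))

lemma partial_trace:
  assumes "x \<in> S" "\<And>i j. (\<lambda>y. h y $ i $ j) differentiable (at x)"
  shows "partial k (tr_g g h) x = (\<Sum>p\<in>UNIV. \<Sum>q\<in>UNIV. ginv g x $ p $ q * nabla_tensor g h x k p q)"
proof -
  have "partial k (tr_g g h) x = (\<Sum>p\<in>UNIV. \<Sum>q\<in>UNIV.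
      partial k (\<lambda>y. ginv g y $ p $ q) x * h x $ p $ q + ginv g x $ p $ q * partial k (\<lambda>y. h y $ p $ q) x)"
    unfolding tr_g_def[abs_def]
    by (simp add: partial_sum partial_mult differentiable_mult differentiable_sum ginv_diff assms)
  also have "\<dots> = (\<Sum>p\<in>UNIV. \<Sum>q\<in>UNIV. ginv g x $ p $ q * nabla_tensor g h x k p q)"
    unfolding partial_ginv[OF assms(1)] nabla_tensor_def by (simp add: sum_3 algebra_simps)
  finally show ?thesis .
qed

text \<open>The left side is the covariant derivative of a contracted tensor, as a 1-form.
  Differentiating the inverse metric supplies exactly the Christoffel terms of the two traced
  slots.\<close>

lemma nabla_contract:
  assumes "x \<in> S" "\<And>a b c. (\<lambda>y. T y a b c) differentiable (at x)"
  shows "partial k (\<lambda>y. \<Sum>p\<in>UNIV. \<Sum>q\<in>UNIV. ginv g y $ p $ q * T y p q b) x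
      - (\<Sum>m\<in>UNIV. christoffel g x m k b * (\<Sum>p\<in>UNIV. \<Sum>q\<in>UNIV. ginv g x $ p $ q * T x p q m))
    = (\<Sum>p\<in>UNIV. \<Sum>q\<in>UNIV. ginv g x $ p $ q * nabla3 g T x k p q b)"
proof -
  have "partial k (\<lambda>y. \<Sum>p\<in>UNIV. \<Sum>q\<in>UNIV. ginv g y $ p $ q * T y p q b) x = (\<Sum>p\<in>UNIV. \<Sum>q\<in>UNIV.
      partial k (\<lambda>y. ginv g y $ p $ q) x * T x p q b + ginv g x $ p $ q * partial k (\<lambda>y. T y p q b) x)"
    by (simp add: partial_sum partial_mult differentiable_mult differentiable_sum ginv_diff assms)
  then show ?thesis
    unfolding partial_ginv[OF assms(1)] nabla3_def by (simp add: sum_3 algebra_simps)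
qed

text \<open>Differentiation commutes with raising an index. The formula is solved for the plain
  partial derivative because the curvature contains partial derivatives of connection coefficients:
  one Christoffel term for the upper index, two of opposite sign for the lower ones.\<close>

lemma nabla_raise:
  assumes "x \<in> S" "\<And>a b c. (\<lambda>y. T y a b c) differentiable (at x)"
  shows "partial k (\<lambda>y. \<Sum>m\<in>UNIV. ginv g y $ i $ m * T y m l j) x =
    (\<Sum>m\<in>UNIV. ginv g x $ i $ m * nabla3 g T x k m l j)
    - (\<Sum>n\<in>UNIV. christoffel g x i k n * (\<Sum>m\<in>UNIV. ginv g x $ n $ m * T x m l j))
    + (\<Sum>n\<in>UNIV. christoffel g x n k l * (\<Sum>m\<in>UNIV. ginv g x $ i $ m * T x m n j))
    + (\<Sum>n\<in>UNIV. christoffel g x n k j * (\<Sum>m\<in>UNIV. ginv g x $ i $ m * T x m l n))"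
proof -
  have "partial k (\<lambda>y. \<Sum>m\<in>UNIV. ginv g y $ i $ m * T y m l j) x = (\<Sum>m\<in>UNIV.
      partial k (\<lambda>y. ginv g y $ i $ m) x * T x m l j + ginv g x $ i $ m * partial k (\<lambda>y. T y m l j) x)"
    by (simp add: partial_sum partial_mult differentiable_mult ginv_diff assms)
  then show ?thesis
    unfolding partial_ginv[OF assms(1)] nabla3_def by (simp add: sum_3 algebra_simps)
qed

text \<open>Second partial derivatives cancel by \<open>partial_commute\<close>, and the terms in
  the derivative slots cancel because the connection is torsion free. The tensor is arbitrary, so
  that the identity applies to the metric as well.\<close>

lemma ricci_identity:
  assumes x: "x \<in> S" and h: "\<And>i j. C_k_on 2 S (\<lambda>y. h y $ i $ j)"
  shows "nabla3 g (nabla_tensor g h) x k l i j - nabla3 g (nabla_tensor g h) x l k i j =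
    - (\<Sum>m\<in>UNIV. riem g x m i k l * h x $ m $ j) - (\<Sum>m\<in>UNIV. riem g x m j k l * h x $ i $ m)"
proof -
  note hd = C2_differentiable[OF h x]
  note d = differentiable_mult differentiable_sum differentiable_diff christoffel_diff[OF x] hd
  have N: "partial k (\<lambda>y. nabla_tensor g h y l i j) x = partial k (partial l (\<lambda>y. h y $ i $ j)) x
     - (\<Sum>m\<in>UNIV. partial k (\<lambda>y. christoffel g y m l i) x * h x $ m $ j + christoffel g x m l i * partial k (\<lambda>y. h y $ m $ j) x)
     - (\<Sum>m\<in>UNIV. partial k (\<lambda>y. christoffel g y m l j) x * h x $ i $ m + christoffel g x m l j * partial k (\<lambda>y. h y $ i $ m) x)"
    for k l
    unfolding nabla_tensor_def
    by (simp add: partial_diff partial_sum partial_mult d)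
  have c: "partial k (partial l (\<lambda>y. h y $ i $ j)) x = partial l (partial k (\<lambda>y. h y $ i $ j)) x"
    by (rule partial_commute[OF open_S x h])
  have s: "(\<Sum>m\<in>UNIV. christoffel g x m k l * X m) = (\<Sum>m\<in>UNIV. christoffel g x m l k * X m)" for X
    by (simp add: christoffel_sym[OF x, of _ k l])
  show ?thesis
    unfolding nabla3_def N c s riem_def
    by (simp add: nabla_tensor_def sum_3 algebra_simps)
qed

end


section \<open>Curvature\<close>

text \<open>Polarizing the vanishing sectional curvature in x and in y, and using pair symmetry,
  shows that B is invariant under cyclic permutation of its last three arguments. The Bianchi sum is
  then 3 B.\<close>

lemma curvature_like_zero:
  fixes B :: "'v::ab_group_add \<Rightarrow> 'v \<Rightarrow> 'v \<Rightarrow> 'v \<Rightarrow> real"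
  assumes add: "\<And>x x' y z w. B (x + x') y z w = B x y z w + B x' y z w"
      "\<And>x y y' z w. B x (y + y') z w = B x y z w + B x y' z w"
      "\<And>x y z z' w. B x y (z + z') w = B x y z w + B x y z' w"
      "\<And>x y z w w'. B x y z (w + w') = B x y z w + B x y z w'"
    and anti1: "\<And>x y z w. B y x z w = - B x y z w"
    and anti2: "\<And>x y z w. B x y w z = - B x y z w"
    and bianchi: "\<And>x y z w. B x y z w + B x z w y + B x w y z = 0"
    and sec: "\<And>x y. B x y x y = 0"
  shows "B x y z w = 0"
proof -
  \<comment> \<open>Pair symmetry combines the Bianchi sums of the four cyclic rotations of the
    arguments with both antisymmetries.\<close>
  have pair: "B z w x y = B x y z w" for x y z w
    using bianchi[of x y z w] bianchi[of y z w x] bianchi[of z w x y] bianchi[of w x y z]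
      anti1[of x y] anti1[of x z] anti1[of x w] anti1[of y z] anti1[of y w] anti1[of z w]
      anti2[of _ _ x y] anti2[of _ _ x z] anti2[of _ _ x w] anti2[of _ _ y z] anti2[of _ _ y w] anti2[of _ _ z w]
    by (smt (verit))
  have pol1: "B x y z y + B z y x y = 0" for x y z
    using sec[of "x + z" y] sec[of x y] sec[of z y] by (simp add: add)
  have pol2: "B x y z w + B x w z y + B z y x w + B z w x y = 0" for x y z w
    using pol1[of x "y + w" z] pol1[of x y z] pol1[of x w z] by (simp add: add)
  have rot: "B x y z w = B x w y z" for x y z w
    using pol2[of x y z w] pair[of z y x w] pair[of z w x y] anti2[of x w z y] by linarith
  show ?thesis
    using bianchi[of x y z w] rot[of x y z w] rot[of x z w y] by linarith
qed

lemma gram_det_pos: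
  assumes sym: "transpose G = G" and pos: "pos_def G" and ind: "u \<noteq> v" "independent {u, v}"
  shows "bil G u u * bil G v v - (bil G u v)\<^sup>2 > 0"
proof -
  have "u \<noteq> 0" using ind dependent_zero[of "{u, v}"] by auto
  then have uu: "bil G u u > 0" using pos by (simp add: pos_def_def)
  \<comment> \<open>The part of v orthogonal to u, scaled by |u|^2 to avoid division; its squared
    length is |u|^2 times the Gram determinant.\<close>
  define p where "p = bil G u u *\<^sub>R v - bil G u v *\<^sub>R u"
  have "p \<noteq> 0"
  proof
    assume "p = 0"
    then have "(1 / bil G u u) *\<^sub>R (bil G u u *\<^sub>R v) = (1 / bil G u u) *\<^sub>R (bil G u v *\<^sub>R u)"
      by (simp add: p_def)
    then have "v = (bil G u v / bil G u u) *\<^sub>R u" using uu by simp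
    then have "v \<in> span {u}" by (metis span_base span_scale singletonI)
    moreover have "v \<notin> span {u}"
      using ind(1) ind(2) independent_insert[of v "{u}"] by (simp add: insert_commute)
    ultimately show False by simp
  qed
  then have "bil G p p > 0" using pos by (simp add: pos_def_def)
  also have "bil G p p = bil G u u * (bil G u u * bil G v v - (bil G u v)\<^sup>2)"
    using bil_commute[OF sym, of v u]
    by (simp add: p_def bil_simps power2_eq_square algebra_simps)
  finally show ?thesis using uu by (simp add: zero_less_mult_iff)
qed

lemma sum_rotate:
  "(\<Sum>j\<in>A. \<Sum>k\<in>B. \<Sum>l\<in>C. f j k l) = (\<Sum>l\<in>C. \<Sum>j\<in>A. \<Sum>k\<in>B. f j k l)"
  by (subst sum.swap[of _ C B], subst sum.swap[of _ C A]) (rule refl)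

section \<open>Symmetries of the curvature tensor and constant sectional curvature\<close>

context riemannian_chart
begin

lemma nabla_metric: "x \<in> S \<Longrightarrow> nabla_tensor g g x k i j = 0"
  by (simp add: nabla_tensor_def partial_g)

lemma nabla2_metric: "x \<in> S \<Longrightarrow> nabla3 g (nabla_tensor g g) x l k i j = 0"
  using partial_cong_S[of x "\<lambda>y. nabla_tensor g g y k i j" "\<lambda>_. 0" l]
  by (simp add: nabla3_def nabla_metric)

definition riem_low :: "real^3 \<Rightarrow> 3 \<Rightarrow> 3 \<Rightarrow> 3 \<Rightarrow> 3 \<Rightarrow> real" where
  "riem_low x i j k l = (\<Sum>m\<in>UNIV. g x $ i $ m * riem g x m j k l)"

text \<open>The Ricci identity for the metric itself, whose second covariant derivative
  vanishes.\<close>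

lemma riem_low_antisym1: "x \<in> S \<Longrightarrow> riem_low x j i k l = - riem_low x i j k l"
  using ricci_identity[OF _ smooth, of x k l i j]
  by (simp add: nabla2_metric riem_low_def sym[of x _ j] mult.commute)

lemma riem_low_antisym2: "riem_low x i j l k = - riem_low x i j k l"
  by (simp add: riem_low_def riem_def sum_negf[symmetric] algebra_simps)

lemma riem_bianchi:
  assumes "x \<in> S"
  shows "riem g x i j k l + riem g x i k l j + riem g x i l j k = 0"
proof -
  have "partial k (\<lambda>y. christoffel g y i l j) x = partial k (\<lambda>y. christoffel g y i j l) x" for j k l
    by (rule partial_cong_S[OF assms christoffel_sym])
  note this[of k l j] this[of l j k] this[of j k l]
  then show ?thesis
    unfolding riem_def by (simp add: christoffel_sym[OF assms, of _ l j]
        christoffel_sym[OF assms, of _ j k] christoffel_sym[OF assms, of _ k l])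
qed

lemma riem_low_bianchi:
  assumes "x \<in> S"
  shows "riem_low x i j k l + riem_low x i k l j + riem_low x i l j k = 0"
  unfolding riem_low_def sum.distrib[symmetric] distrib_left[symmetric] riem_bianchi[OF assms] by simp

definition riem_form :: "real^3 \<Rightarrow> real^3 \<Rightarrow> real^3 \<Rightarrow> real^3 \<Rightarrow> real^3 \<Rightarrow> real" where
  "riem_form x u v w z = (\<Sum>i\<in>UNIV. \<Sum>j\<in>UNIV. \<Sum>k\<in>UNIV. \<Sum>l\<in>UNIV. riem_low x i j k l * u $ i * v $ j * w $ k * z $ l)"

lemma riem_form_add:
  "riem_form x (u + u') v w z = riem_form x u v w z + riem_form x u' v w z"
  "riem_form x u (v + v') w z = riem_form x u v w z + riem_form x u v' w z"
  "riem_form x u v (w + w') z = riem_form x u v w z + riem_form x u v w' z"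
  "riem_form x u v w (z + z') = riem_form x u v w z + riem_form x u v w z'"
  by (simp_all add: riem_form_def algebra_simps sum.distrib)

lemma riem_form_antisym1:
  assumes "x \<in> S"
  shows "riem_form x v u w z = - riem_form x u v w z"
proof -
  have "riem_form x v u w z = (\<Sum>i\<in>UNIV. \<Sum>j\<in>UNIV. \<Sum>k\<in>UNIV. \<Sum>l\<in>UNIV. riem_low x j i k l * v $ j * u $ i * w $ k * z $ l)"
    unfolding riem_form_def by (rule sum.swap)
  also have "\<dots> = (\<Sum>i\<in>UNIV. \<Sum>j\<in>UNIV. \<Sum>k\<in>UNIV. \<Sum>l\<in>UNIV. - (riem_low x i j k l * u $ i * v $ j * w $ k * z $ l))"
    by (intro sum.cong refl, subst riem_low_antisym1[OF assms]) simp
  finally show ?thesis by (simp add: riem_form_def sum_negf)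
qed

lemma riem_form_antisym2: "riem_form x u v z w = - riem_form x u v w z"
proof -
  have "riem_form x u v z w = (\<Sum>i\<in>UNIV. \<Sum>j\<in>UNIV. \<Sum>k\<in>UNIV. \<Sum>l\<in>UNIV. riem_low x i j l k * u $ i * v $ j * z $ l * w $ k)"
    unfolding riem_form_def by (intro sum.cong refl sum.swap)
  also have "\<dots> = (\<Sum>i\<in>UNIV. \<Sum>j\<in>UNIV. \<Sum>k\<in>UNIV. \<Sum>l\<in>UNIV. - (riem_low x i j k l * u $ i * v $ j * w $ k * z $ l))"
    by (intro sum.cong refl, subst riem_low_antisym2) simp
  finally show ?thesis by (simp add: riem_form_def sum_negf)
qed

lemma riem_form_bianchi:
  assumes "x \<in> S"
  shows "riem_form x u v w z + riem_form x u w z v + riem_form x u z v w = 0"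
proof -
  have 1: "(\<Sum>j\<in>UNIV. \<Sum>k\<in>UNIV. \<Sum>l\<in>UNIV. riem_low x i j k l * u $ i * w $ j * z $ k * v $ l)
     = (\<Sum>j\<in>UNIV. \<Sum>k\<in>UNIV. \<Sum>l\<in>UNIV. riem_low x i k l j * u $ i * v $ j * w $ k * z $ l)" for i
    by (subst sum_rotate) (simp add: mult_ac)
  have 2: "(\<Sum>j\<in>UNIV. \<Sum>k\<in>UNIV. \<Sum>l\<in>UNIV. riem_low x i j k l * u $ i * z $ j * v $ k * w $ l)
     = (\<Sum>j\<in>UNIV. \<Sum>k\<in>UNIV. \<Sum>l\<in>UNIV. riem_low x i l j k * u $ i * v $ j * w $ k * z $ l)" for i
    by (subst sum_rotate, subst sum_rotate) (simp add: mult_ac)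
  show ?thesis
    unfolding riem_form_def 1 2 sum.distrib[symmetric] distrib_right[symmetric] riem_low_bianchi[OF assms]
    by simp
qed

lemma sectional_numerator:
  assumes "x \<in> S"
  shows "bil (g x) (\<chi> i. \<Sum>j\<in>UNIV. \<Sum>k\<in>UNIV. \<Sum>l\<in>UNIV. riem g x i j k l * v $ j * w $ k * z $ l) u
    = riem_form x u v w z"
proof -
  let ?a = "\<lambda>m. \<Sum>j\<in>UNIV. \<Sum>k\<in>UNIV. \<Sum>l\<in>UNIV. riem g x m j k l * v $ j * w $ k * z $ l"
  have lin: "(\<Sum>j\<in>UNIV. \<Sum>k\<in>UNIV. \<Sum>l\<in>UNIV. (\<Sum>m\<in>UNIV. G m * R m j k l) * c * v $ j * w $ k * z $ l)
    = (\<Sum>m\<in>UNIV. G m * (\<Sum>j\<in>UNIV. \<Sum>k\<in>UNIV. \<Sum>l\<in>UNIV. R m j k l * v $ j * w $ k * z $ l) * c)"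
    for G and R :: "3 \<Rightarrow> 3 \<Rightarrow> 3 \<Rightarrow> 3 \<Rightarrow> real" and c
    by (simp add: sum_3 algebra_simps)
  have "riem_form x u v w z = (\<Sum>i\<in>UNIV. \<Sum>m\<in>UNIV. g x $ i $ m * ?a m * u $ i)"
    unfolding riem_form_def riem_low_def lin ..
  also have "\<dots> = (\<Sum>m\<in>UNIV. \<Sum>i\<in>UNIV. g x $ m $ i * ?a m * u $ i)"
    by (subst sum.swap) (intro sum.cong refl, subst sym[OF assms], rule refl)
  finally show ?thesis by (simp add: bil_def)
qed

lemma transpose_metric: "x \<in> S \<Longrightarrow> transpose (g x) = g x"
  by (simp add: transpose_def vec_eq_iff sym)

lemma riem_form_constant_curvature:
  assumes x: "x \<in> S"
    and sec: "\<And>u v. u \<noteq> v \<Longrightarrow> independent {u, v} \<Longrightarrow> sectional_curvature g x u v = \<kappa>"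
  shows "riem_form x u v w z = \<kappa> * (bil (g x) u w * bil (g x) v z - bil (g x) u z * bil (g x) v w)"
proof -
  let ?b = "bil (g x)"
  note c = bil_commute[OF transpose_metric[OF x]]
  \<comment> \<open>The deviation from the model tensor of curvature \<kappa>. It has all curvature
    symmetries and vanishes on planes, so \<open>curvature_like_zero\<close> applies.\<close>
  define B where "B u v w z = riem_form x u v w z - \<kappa> * (?b u w * ?b v z - ?b u z * ?b v w)" for u v w z
  have anti1: "B v u w z = - B u v w z" for u v w z
    using riem_form_antisym1[OF x, of v u w z] by (simp add: B_def algebra_simps)
  have anti2: "B u v z w = - B u v w z" for u v w z
    using riem_form_antisym2[of x u v z w] by (simp add: B_def algebra_simps)
  have bianchi: "B u v w z + B u w z v + B u z v w = 0" for u v w z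
    using riem_form_bianchi[OF x, of u v w z] c[of w v] c[of z v] c[of z w]
    by (simp add: B_def algebra_simps)
  have diag: "B u v u v = 0" for u v
  proof (cases "u \<noteq> v \<and> independent {u, v}")
    case True
    then have "riem_form x u v u v / (?b u u * ?b v v - (?b u v)\<^sup>2) = \<kappa>"
      using sec unfolding sectional_curvature_def sectional_numerator[OF x] by blast
    then show ?thesis
      using gram_det_pos[OF transpose_metric[OF x] pos[OF x], of u v] True c[of v u]
      by (simp add: B_def field_simps power2_eq_square)
  next
    case False
    \<comment> \<open>Dependent vectors span no plane and the curvature hypothesis says nothing
      about them; antisymmetry and homogeneity in the first argument give the value instead.\<close>
    have same: "B u u w z = 0" for u w z using anti1[of u u w z] by simp
    have "u = v \<or> u \<in> span {v} \<or> v = 0"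
      using False by (auto simp: independent_insert split: if_splits)
    then consider "u = v" | "v = 0" | r where "u = r *\<^sub>R v"
      by (auto simp: span_singleton)
    then show ?thesis
    proof cases
      case 3
      have "B (r *\<^sub>R v) v w z = r * B v v w z" for w z
        by (simp add: B_def bil_simps riem_form_def sum_distrib_left algebra_simps)
      then show ?thesis by (simp add: 3 same)
    qed (simp_all add: same B_def riem_form_def bil_def)
  qed
  have "B u v w z = 0"
    by (rule curvature_like_zero[of B]; (rule anti1 anti2 bianchi diag)?)
      (simp_all add: B_def riem_form_add bil_simps algebra_simps)
  then show ?thesis by (simp add: B_def)
qed

lemma riem_constant_curvature:
  assumes x: "x \<in> S"
    and sec: "\<And>u v. u \<noteq> v \<Longrightarrow> independent {u, v} \<Longrightarrow> sectional_curvature g x u v = \<kappa>"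
  shows "riem g x i j k l = \<kappa> * ((if i = k then 1 else 0) * g x $ j $ l - (if i = l then 1 else 0) * g x $ j $ k)"
proof -
  have bil_axis: "bil (g x) (axis i 1) (axis j 1) = g x $ i $ j" for i j
    by (simp add: bil_def axis_def mult_delta_left mult_delta_right)
  have form_axis: "riem_form x (axis i 1) (axis j 1) (axis k 1) (axis l 1) = riem_low x i j k l" for i j k l
    by (simp add: riem_form_def axis_def mult_delta_left mult_delta_right)
  have low: "riem_low x i j k l = \<kappa> * (g x $ i $ k * g x $ j $ l - g x $ i $ l * g x $ j $ k)" for i j k l
    using riem_form_constant_curvature[OF x sec, of "axis i 1" "axis j 1" "axis k 1" "axis l 1"]
    unfolding bil_axis form_axis .
  let ?P = "\<lambda>a. ginv g x $ i $ a"
  have "riem g x i j k l = (\<Sum>m\<in>UNIV. riem g x m j k l * (\<Sum>a\<in>UNIV. ?P a * g x $ a $ m))"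
    by (simp only: ginv_sum(2)[OF x] sum_delta_mult)
  also have "\<dots> = (\<Sum>a\<in>UNIV. ?P a * riem_low x a j k l)"
    unfolding riem_low_def sum_distrib_left by (subst sum.swap) (simp only: mult_ac)
  also have "\<dots> = \<kappa> * ((\<Sum>a\<in>UNIV. ?P a * g x $ a $ k) * g x $ j $ l - (\<Sum>a\<in>UNIV. ?P a * g x $ a $ l) * g x $ j $ k)"
    unfolding low by (simp add: sum_distrib_left sum_distrib_right sum_subtractf algebra_simps)
  finally show ?thesis by (simp only: ginv_sum(2)[OF x])
qed

end


section \<open>Variation of the curvature\<close>

locale metric_variation = riemannian_chart +
  fixes h :: tensor_comp
  assumes h_smooth: "\<And>i j. C_k_on 2 S (\<lambda>y. h y $ i $ j)"
    and h_sym: "\<And>y i j. y \<in> S \<Longrightarrow> h y $ i $ j = h y $ j $ i"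
begin

section \<open>The connection and curvature of the varied metric\<close>

abbreviation varied :: "real \<Rightarrow> tensor_comp" where
  "varied t \<equiv> (\<lambda>y. g y + t *\<^sub>R h y)"

lemmas h_diff = C2_differentiable[OF h_smooth]

lemma varied_diff: "x \<in> S \<Longrightarrow> (\<lambda>y. varied t y $ i $ j) differentiable (at x)"
  by (simp add: differentiable_add differentiable_mult g_diff h_diff)

lemma partial_varied:
  "x \<in> S \<Longrightarrow> partial k (\<lambda>y. varied t y $ i $ j) x = partial k (\<lambda>y. g y $ i $ j) x + t * partial k (\<lambda>y. h y $ i $ j) x"
  by (simp add: partial_add partial_cmult differentiable_mult g_diff h_diff)

text \<open>\<Lambda>_t with its upper index lowered by g_t. In this form it does not depend on t;
  all t-dependence comes from the inverse metric in \<open>var_christoffel\<close>.\<close>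

definition var_low :: "real^3 \<Rightarrow> 3 \<Rightarrow> 3 \<Rightarrow> 3 \<Rightarrow> real" where
  "var_low y l i j = (1/2) * (nabla_tensor g h y i j l + nabla_tensor g h y j i l - nabla_tensor g h y l i j)"

definition var_christoffel :: "real \<Rightarrow> real^3 \<Rightarrow> 3 \<Rightarrow> 3 \<Rightarrow> 3 \<Rightarrow> real" where
  "var_christoffel t y k i j = (\<Sum>l\<in>UNIV. ginv (varied t) y $ k $ l * var_low y l i j)"

text \<open>Of the six Christoffel terms in the three covariant derivatives of h, four cancel by
  symmetry and the remaining two are equal.\<close>

lemma var_low_eq:
  assumes "y \<in> S"
  shows "(partial i (\<lambda>y. h y $ j $ l) y + partial j (\<lambda>y. h y $ i $ l) y - partial l (\<lambda>y. h y $ i $ j) y) / 2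
    = (\<Sum>m\<in>UNIV. h y $ l $ m * christoffel g y m i j) + var_low y l i j"
proof -
  note c = christoffel_sym[OF assms]
  show ?thesis
    using h_sym[OF assms, of _ l] h_sym[OF assms, of _ j] c[of _ j i] c[of _ l i] c[of _ l j]
    by (simp add: var_low_def nabla_tensor_def sum_3 field_simps)
qed

text \<open>Christoffel symbols of the first kind are linear in the metric, so after lowering the
  index with g_t the t-dependence is affine and the equation is exact. Multiplying by the inverse of
  g_t gives back the symbols.\<close>

lemma christoffel_varied:
  assumes y: "y \<in> S" and nz: "det (varied t y) \<noteq> 0"
  shows "christoffel (varied t) y k i j = christoffel g y k i j + t * var_christoffel t y k i j"
proof -
  let ?P = "\<lambda>l. ginv (varied t) y $ k $ l"
  have inv: "(\<Sum>l\<in>UNIV. ?P l * varied t y $ l $ m) = (if k = m then 1 else 0)" for m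
    using matrix_inv_sum(2)[OF nz] unfolding ginv_def .
  have low: "(1/2) * (partial i (\<lambda>y. varied t y $ j $ l) y + partial j (\<lambda>y. varied t y $ i $ l) y - partial l (\<lambda>y. varied t y $ i $ j) y)
     = (\<Sum>m\<in>UNIV. varied t y $ l $ m * christoffel g y m i j) + t * var_low y l i j" for l
  proof -
    let ?C = "\<lambda>f :: tensor_comp. (partial i (\<lambda>y. f y $ j $ l) y + partial j (\<lambda>y. f y $ i $ l) y - partial l (\<lambda>y. f y $ i $ j) y) / 2"
    have split: "(\<Sum>m\<in>UNIV. varied t y $ l $ m * christoffel g y m i j)
       = (\<Sum>m\<in>UNIV. g y $ l $ m * christoffel g y m i j) + t * (\<Sum>m\<in>UNIV. h y $ l $ m * christoffel g y m i j)"
      by (simp add: sum.distrib sum_distrib_left algebra_simps)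
    have "(1/2) * (partial i (\<lambda>y. varied t y $ j $ l) y + partial j (\<lambda>y. varied t y $ i $ l) y - partial l (\<lambda>y. varied t y $ i $ j) y)
       = ?C g + t * ?C h"
      by (simp only: partial_varied[OF y]) (simp add: field_simps)
    then show ?thesis
      unfolding split var_low_eq[OF y] christoffel_lower[OF y, symmetric] by (simp add: distrib_left)
  qed
  have "christoffel (varied t) y k i j = (\<Sum>l\<in>UNIV. ?P l *
      ((\<Sum>m\<in>UNIV. varied t y $ l $ m * christoffel g y m i j) + t * var_low y l i j))"
    unfolding christoffel_def[of "varied t"] low[symmetric] sum_distrib_left
    by (intro sum.cong refl) (rule mult.left_commute)
  also have "\<dots> = (\<Sum>l\<in>UNIV. \<Sum>m\<in>UNIV. ?P l * varied t y $ l $ m * christoffel g y m i j) + t * var_christoffel t y k i j"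
    by (simp add: var_christoffel_def sum.distrib sum_distrib_left algebra_simps)
  also have "(\<Sum>l\<in>UNIV. \<Sum>m\<in>UNIV. ?P l * varied t y $ l $ m * christoffel g y m i j) = christoffel g y k i j"
    by (subst sum.swap) (simp only: sum_distrib_right[symmetric] inv sum_delta_mult)
  finally show ?thesis .
qed

lemma var_low_diff: "x \<in> S \<Longrightarrow> (\<lambda>y. var_low y l i j) differentiable (at x)"
  unfolding var_low_def
  by (intro differentiable_mult differentiable_const differentiable_add differentiable_diff
      nabla_tensor_diff h_smooth)

lemma ginv_varied_diff:
  "x \<in> S \<Longrightarrow> det (varied t x) \<noteq> 0 \<Longrightarrow> (\<lambda>y. ginv (varied t) y $ i $ j) differentiable (at x)"
  unfolding ginv_def by (intro differentiable_matrix_inv_3 varied_diff)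

lemma var_christoffel_diff:
  "x \<in> S \<Longrightarrow> det (varied t x) \<noteq> 0 \<Longrightarrow> (\<lambda>y. var_christoffel t y k i j) differentiable (at x)"
  unfolding var_christoffel_def
  by (intro differentiable_sum ballI finite differentiable_mult ginv_varied_diff var_low_diff)

lemma partial_christoffel_varied:
  assumes x: "x \<in> S" and nz: "det (varied t x) \<noteq> 0"
  shows "partial l (\<lambda>y. christoffel (varied t) y k i j) x =
    partial l (\<lambda>y. christoffel g y k i j) x + t * partial l (\<lambda>y. var_christoffel t y k i j) x"
proof -
  have "\<forall>\<^sub>F y in nhds x. y \<in> S" using open_S x by (meson eventually_nhds)
  \<comment> \<open>To be differentiated at x the identity must hold near x; t stays fixed, and
    invertibility spreads to nearby points by continuity.\<close>
  moreover have "\<forall>\<^sub>F y in nhds x. det (varied t y) \<noteq> 0"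
    by (rule eventually_det_nz[OF varied_diff[OF x] nz])
  ultimately have "\<forall>\<^sub>F y in nhds x. christoffel (varied t) y k i j = christoffel g y k i j + t * var_christoffel t y k i j"
    by eventually_elim (rule christoffel_varied)
  then have "partial l (\<lambda>y. christoffel (varied t) y k i j) x = partial l (\<lambda>y. christoffel g y k i j + t * var_christoffel t y k i j) x"
    by (rule partial_cong_ev)
  then show ?thesis
    using x nz by (simp add: partial_add partial_cmult differentiable_mult christoffel_diff var_christoffel_diff)
qed

text \<open>The difference quotient of the curvature tensor, in a form that makes sense at \<open>t = 0\<close>.\<close>
definition riem_quotient :: "real \<Rightarrow> real^3 \<Rightarrow> 3 \<Rightarrow> 3 \<Rightarrow> 3 \<Rightarrow> 3 \<Rightarrow> real" where
  "riem_quotient t x i j k l =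
     partial k (\<lambda>y. var_christoffel t y i l j) x - partial l (\<lambda>y. var_christoffel t y i k j) x
     + (\<Sum>m\<in>UNIV. christoffel g x i k m * var_christoffel t x m l j + var_christoffel t x i k m * christoffel g x m l j)
     - (\<Sum>m\<in>UNIV. christoffel g x i l m * var_christoffel t x m k j + var_christoffel t x i l m * christoffel g x m k j)
     + t * (\<Sum>m\<in>UNIV. var_christoffel t x i k m * var_christoffel t x m l j - var_christoffel t x i l m * var_christoffel t x m k j)"

lemma riem_varied:
  assumes x: "x \<in> S" and nz: "det (varied t x) \<noteq> 0"
  shows "riem (varied t) x i j k l = riem g x i j k l + t * riem_quotient t x i j k l"
  unfolding riem_def riem_quotient_def partial_christoffel_varied[OF assms] christoffel_varied[OF assms]
  by (simp add: sum_3 algebra_simps)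

section \<open>Limits and derivatives at t = 0\<close>

lemma varied_tendsto: "((\<lambda>t. varied t x $ i $ j) \<longlongrightarrow> g x $ i $ j) (at 0)"
proof -
  have "((\<lambda>t. varied t x $ i $ j) \<longlongrightarrow> g x $ i $ j + 0 * h x $ i $ j) (at 0)"
    by (simp only: vector_add_component vector_scaleR_component real_scaleR_def) (intro tendsto_intros)
  then show ?thesis by simp
qed

lemma ginv_varied_tendsto:
  "x \<in> S \<Longrightarrow> ((\<lambda>t. ginv (varied t) x $ i $ j) \<longlongrightarrow> ginv g x $ i $ j) (at 0)"
  unfolding ginv_def by (intro tendsto_matrix_inv_3 varied_tendsto det_nz)

lemma eventually_varied_det_nz: "x \<in> S \<Longrightarrow> \<forall>\<^sub>F t in at 0. det (varied t x) \<noteq> 0"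
  by (rule tendsto_imp_eventually_ne[OF tendsto_det_3[OF varied_tendsto] det_nz])

lemma varied_0: "varied 0 = g"
  by simp

lemma var_christoffel_tendsto:
  "x \<in> S \<Longrightarrow> ((\<lambda>t. var_christoffel t x k i j) \<longlongrightarrow> var_christoffel 0 x k i j) (at 0)"
  unfolding var_christoffel_def varied_0
  by (intro tendsto_sum tendsto_mult ginv_varied_tendsto tendsto_const)

text \<open>On the right t occurs only in values of the inverse metric at x and in a linear factor,
  so the limit of this spatial derivative needs no uniformity in t.\<close>

lemma partial_var_christoffel:
  assumes x: "x \<in> S" and nz: "det (varied t x) \<noteq> 0"
  shows "partial l (\<lambda>y. var_christoffel t y k i j) x = (\<Sum>m\<in>UNIV.
      - (\<Sum>a\<in>UNIV. \<Sum>b\<in>UNIV. ginv (varied t) x $ k $ a *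
           (partial l (\<lambda>y. g y $ a $ b) x + t * partial l (\<lambda>y. h y $ a $ b) x) * ginv (varied t) x $ b $ m) * var_low x m i j
      + ginv (varied t) x $ k $ m * partial l (\<lambda>y. var_low y m i j) x)"
proof -
  have "partial l (\<lambda>y. ginv (varied t) y $ k $ m) x = - (\<Sum>a\<in>UNIV. \<Sum>b\<in>UNIV. ginv (varied t) x $ k $ a *
           (partial l (\<lambda>y. g y $ a $ b) x + t * partial l (\<lambda>y. h y $ a $ b) x) * ginv (varied t) x $ b $ m)" for m
    unfolding partial_varied[OF x, symmetric] ginv_def
    by (rule partial_matrix_inv_3[OF varied_diff[OF x] nz])
  then show ?thesis
    unfolding var_christoffel_def
    using x nz by (simp add: partial_sum partial_mult differentiable_mult ginv_varied_diff var_low_diff)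
qed

lemma partial_var_christoffel_tendsto:
  assumes x: "x \<in> S"
  shows "((\<lambda>t. partial l (\<lambda>y. var_christoffel t y k i j) x) \<longlongrightarrow> partial l (\<lambda>y. var_christoffel 0 y k i j) x) (at 0)"
proof -
  let ?D = "\<lambda>t. \<Sum>m\<in>UNIV.
      - (\<Sum>a\<in>UNIV. \<Sum>b\<in>UNIV. ginv (varied t) x $ k $ a *
           (partial l (\<lambda>y. g y $ a $ b) x + t * partial l (\<lambda>y. h y $ a $ b) x) * ginv (varied t) x $ b $ m) * var_low x m i j
      + ginv (varied t) x $ k $ m * partial l (\<lambda>y. var_low y m i j) x"
  have nz: "det (varied 0 x) \<noteq> 0" using det_nz[OF x] by simp
  show ?thesis
    unfolding partial_var_christoffel[OF x nz] varied_0
  proof (rule Lim_transform_eventually)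
    show "\<forall>\<^sub>F t in at 0. ?D t = partial l (\<lambda>y. var_christoffel t y k i j) x"
      using eventually_varied_det_nz[OF x] by eventually_elim (rule partial_var_christoffel[OF x, symmetric])
  qed (intro tendsto_sum tendsto_add tendsto_minus tendsto_mult ginv_varied_tendsto x tendsto_const tendsto_ident_at)
qed

lemma riem_quotient_tendsto:
  "x \<in> S \<Longrightarrow> ((\<lambda>t. riem_quotient t x i j k l) \<longlongrightarrow> riem_quotient 0 x i j k l) (at 0)"
  unfolding riem_quotient_def
  by (intro tendsto_add tendsto_diff tendsto_sum tendsto_mult tendsto_const tendsto_ident_at
      var_christoffel_tendsto partial_var_christoffel_tendsto)

lemma riem_varied_deriv:
  assumes x: "x \<in> S"
  shows "((\<lambda>t. riem (varied t) x i j k l) has_real_derivative riem_quotient 0 x i j k l) (at 0)"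
  unfolding DERIV_def
proof (rule Lim_transform_eventually[OF riem_quotient_tendsto[OF x]])
  have "\<forall>\<^sub>F t in at (0::real). t \<noteq> 0" by (simp add: eventually_at_filter)
  with eventually_varied_det_nz[OF x]
  show "\<forall>\<^sub>F t in at 0. riem_quotient t x i j k l
      = (riem (varied (0 + t)) x i j k l - riem (varied 0) x i j k l) / t"
    by eventually_elim (simp add: riem_varied[OF x])
qed

text \<open>The resolvent identity g_t^-1 - g^-1 = - t g_t^-1 h g^-1 is exact, so the difference
  quotient is continuous in t by inspection.\<close>

lemma ginv_varied_deriv:
  assumes x: "x \<in> S"
  shows "((\<lambda>t. ginv (varied t) x $ i $ j) has_real_derivative
     - (\<Sum>m\<in>UNIV. (\<Sum>l\<in>UNIV. ginv g x $ i $ l * h x $ l $ m) * ginv g x $ m $ j)) (at 0)"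
  unfolding DERIV_def
proof (rule Lim_transform_eventually)
  have "\<forall>\<^sub>F t in at (0::real). t \<noteq> 0" by (simp add: eventually_at_filter)
  with eventually_varied_det_nz[OF x]
  show "\<forall>\<^sub>F t in at 0. - (\<Sum>m\<in>UNIV. (\<Sum>l\<in>UNIV. ginv (varied t) x $ i $ l * h x $ l $ m) * ginv g x $ m $ j)
      = (ginv (varied (0 + t)) x $ i $ j - ginv (varied 0) x $ i $ j) / t"
  proof eventually_elim
    case (elim t)
    let ?Q = "\<lambda>l. ginv (varied t) x $ i $ l"
    have "t * (\<Sum>l\<in>UNIV. ?Q l * h x $ l $ m) = (if i = m then 1 else 0) - (\<Sum>l\<in>UNIV. ?Q l * g x $ l $ m)" for m
    proof -
      have "(\<Sum>l\<in>UNIV. ?Q l * g x $ l $ m) + t * (\<Sum>l\<in>UNIV. ?Q l * h x $ l $ m) = (if i = m then 1 else 0)"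
        using matrix_inv_sum(2)[OF elim(1), of i m]
        by (simp add: ginv_def distrib_left sum.distrib sum_distrib_left mult_ac)
      then show ?thesis by linarith
    qed
    then have "t * (\<Sum>m\<in>UNIV. (\<Sum>l\<in>UNIV. ?Q l * h x $ l $ m) * ginv g x $ m $ j) =
       (\<Sum>m\<in>UNIV. ((if i = m then 1 else 0) - (\<Sum>l\<in>UNIV. ?Q l * g x $ l $ m)) * ginv g x $ m $ j)"
      by (simp only: sum_distrib_left mult.assoc[symmetric])
    also have "\<dots> = ginv g x $ i $ j - ?Q j"
      by (simp only: left_diff_distrib sum_subtractf sum_delta_mult contract_inverse[OF ginv_sum(1)[OF x]])
    finally show ?case using elim(2) by (simp add: field_simps)
  qed
  show "((\<lambda>t. - (\<Sum>m\<in>UNIV. (\<Sum>l\<in>UNIV. ginv (varied t) x $ i $ l * h x $ l $ m) * ginv g x $ m $ j)) \<longlongrightarrow>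
     - (\<Sum>m\<in>UNIV. (\<Sum>l\<in>UNIV. ginv g x $ i $ l * h x $ l $ m) * ginv g x $ m $ j)) (at 0)"
    by (intro tendsto_minus tendsto_sum tendsto_mult ginv_varied_tendsto x tendsto_const)
qed

section \<open>Covariant form of the curvature variation\<close>

lemma nabla3_var_low:
  assumes x: "x \<in> S"
  shows "nabla3 g var_low x k m l j = (1/2) * (nabla3 g (nabla_tensor g h) x k l j m
    + nabla3 g (nabla_tensor g h) x k j l m - nabla3 g (nabla_tensor g h) x k m l j)"
proof -
  note d = nabla_tensor_diff[OF x h_smooth]
  have "partial k (\<lambda>y. var_low y m l j) x = (1/2) * (partial k (\<lambda>y. nabla_tensor g h y l j m) x
    + partial k (\<lambda>y. nabla_tensor g h y j l m) x - partial k (\<lambda>y. nabla_tensor g h y m l j) x)"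
    unfolding var_low_def
    by (simp only: partial_cmult partial_add partial_diff differentiable_add differentiable_diff d)
  then show ?thesis
    unfolding nabla3_def by (simp add: var_low_def sum_3 field_simps)
qed

text \<open>The Palatini identity. The terms linear in \<Lambda> complete its partial derivatives to
  covariant ones, the Christoffel terms in k and l cancel in the antisymmetrization, and the
  quadratic part carries the factor t = 0.\<close>

lemma riem_quotient_0:
  assumes x: "x \<in> S"
  shows "riem_quotient 0 x i j k l =
    (\<Sum>m\<in>UNIV. ginv g x $ i $ m * (nabla3 g var_low x k m l j - nabla3 g var_low x l m k j))"
proof -
  have s: "(\<Sum>m\<in>UNIV. christoffel g x m k l * X m) = (\<Sum>m\<in>UNIV. christoffel g x m l k * X m)" for X
    by (simp add: christoffel_sym[OF x, of _ k l])
  show ?thesis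
    unfolding riem_quotient_def var_christoffel_def varied_0
      nabla_raise[of x var_low, OF x var_low_diff[OF x]] s
    by (simp add: sum.distrib sum_subtractf right_diff_distrib mult.commute)
qed

lemma nabla_tensor_sym: "x \<in> S \<Longrightarrow> nabla_tensor g h x k i j = nabla_tensor g h x k j i"
  using partial_cong_S[of x "\<lambda>y. h y $ i $ j" "\<lambda>y. h y $ j $ i" k, OF _ h_sym]
  by (simp add: nabla_tensor_def h_sym[of x _ i] h_sym[of x _ j])

lemma nabla2_sym:
  assumes "x \<in> S"
  shows "nabla3 g (nabla_tensor g h) x l k i j = nabla3 g (nabla_tensor g h) x l k j i"
proof -
  have "partial l (\<lambda>y. nabla_tensor g h y k i j) x = partial l (\<lambda>y. nabla_tensor g h y k j i) x"
    by (rule partial_cong_S[OF assms nabla_tensor_sym])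
  moreover have "(\<Sum>m\<in>UNIV. c m * nabla_tensor g h x k m i) = (\<Sum>m\<in>UNIV. c m * nabla_tensor g h x k i m)"
    "(\<Sum>m\<in>UNIV. c m * nabla_tensor g h x k m j) = (\<Sum>m\<in>UNIV. c m * nabla_tensor g h x k j m)"
    "(\<Sum>m\<in>UNIV. c m * nabla_tensor g h x m i j) = (\<Sum>m\<in>UNIV. c m * nabla_tensor g h x m j i)" for c
    by (intro sum.cong refl arg_cong2[where f = "(*)"] nabla_tensor_sym[OF assms])+
  ultimately show ?thesis by (simp add: nabla3_def)
qed

end

lemma has_vector_derivative_matrixI:
  fixes f :: "real \<Rightarrow> real^'n::finite^'m::finite"
  assumes "\<And>i j. ((\<lambda>t. f t $ i $ j) has_real_derivative D $ i $ j) (at a)"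
  shows "(f has_vector_derivative D) (at a)"
  unfolding has_vector_derivative_def
proof (subst has_derivative_componentwise_within, intro ballI)
  fix b :: "real^'n^'m" assume "b \<in> Basis"
  then obtain i j where b: "b = axis i (axis j 1)" by (auto simp: Basis_vec_def)
  show "((\<lambda>t. f t \<bullet> b) has_derivative (\<lambda>t. (t *\<^sub>R D) \<bullet> b)) (at a)"
    using assms[of i j] by (simp add: b inner_axis has_field_derivative_def mult.commute[of _ "D $ i $ j"])
qed


section \<open>The volume form\<close>

text \<open>As a determinant of axis vectors, so that a product of two symbols is the determinant of
  a 3 by 3 matrix of Kronecker deltas, which is how \<open>levi_civita_prod\<close> obtains its six
  terms.\<close>

definition levi_civita :: "3 \<Rightarrow> 3 \<Rightarrow> 3 \<Rightarrow> real" where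
  "levi_civita i j k = det (vector [axis i 1, axis j 1, axis k 1] :: real^3^3)"

lemma levi_civita_simps [simp]:
  "levi_civita 1 2 3 = 1" "levi_civita 2 3 1 = 1" "levi_civita 3 1 2 = 1"
  "levi_civita 1 3 2 = -1" "levi_civita 3 2 1 = -1" "levi_civita 2 1 3 = -1"
  "levi_civita i i j = 0" "levi_civita i j i = 0" "levi_civita j i i = 0"
  by (simp_all add: levi_civita_def det_3 axis_def)

lemma levi_civita_antisym: "levi_civita i k j = - levi_civita i j k"
  by (simp add: levi_civita_def det_3 algebra_simps)

lemma levi_civita_prod:
  fixes m p q b k l :: 3
  defines "\<delta> \<equiv> \<lambda>i j. if i = j then 1 else (0::real)"
  shows "levi_civita m p q * levi_civita b k l =
    \<delta> m b * (\<delta> p k * \<delta> q l - \<delta> p l * \<delta> q k) - \<delta> m k * (\<delta> p b * \<delta> q l - \<delta> p l * \<delta> q b)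
    + \<delta> m l * (\<delta> p b * \<delta> q k - \<delta> p k * \<delta> q b)"
proof -
  let ?A = "vector [axis m 1, axis p 1, axis q 1] :: real^3^3"
  let ?B = "vector [axis b 1, axis k 1, axis l 1] :: real^3^3"
  have entry: "(?A ** transpose ?B) $ i $ j = ?A $ i \<bullet> ?B $ j" for i j
    by (simp add: matrix_matrix_mult_def transpose_def inner_vec_def)
  have inner: "axis i (1::real) \<bullet> axis j 1 = \<delta> i j" for i j :: 3
    by (simp add: inner_axis_axis \<delta>_def)
  have "levi_civita m p q * levi_civita b k l = det (?A ** transpose ?B)"
    by (simp add: levi_civita_def det_mul)
  also have "\<dots> = \<delta> m b * (\<delta> p k * \<delta> q l - \<delta> p l * \<delta> q k) - \<delta> m k * (\<delta> p b * \<delta> q l - \<delta> p l * \<delta> q b)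
    + \<delta> m l * (\<delta> p b * \<delta> q k - \<delta> p k * \<delta> q b)"
    unfolding det_3 entry by (simp add: inner algebra_simps)
  finally show ?thesis .
qed

lemma levi_civita_contract:
  "(\<Sum>q\<in>UNIV. levi_civita m p q * levi_civita q k l) =
    (if m = k then 1 else 0) * (if p = l then 1 else 0) - (if m = l then 1 else 0) * (if p = k then 1 else 0)"
  using exhaust_3[of m] exhaust_3[of p] exhaust_3[of k] exhaust_3[of l]
  by (elim disjE) (simp_all add: sum_3)

lemma levi_civita_det:
  fixes P :: "real^3^3"
  shows "(\<Sum>n\<in>UNIV. \<Sum>k\<in>UNIV. \<Sum>l\<in>UNIV. levi_civita n k l * P $ n $ m * P $ k $ p * P $ l $ q) = det P * levi_civita m p q"
  using exhaust_3[of m] exhaust_3[of p] exhaust_3[of q]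
  by (elim disjE) (simp_all add: sum_3 det_3 algebra_simps)

text \<open>The linearization of \<open>levi_civita_det\<close> at the identity: a matrix acts on a
  volume form through its trace. With Christoffel symbols for c this cancels the derivative of the
  determinant.\<close>

lemma levi_civita_trace:
  fixes c :: "3 \<Rightarrow> 3 \<Rightarrow> real"
  shows "(\<Sum>m\<in>UNIV. c n m * levi_civita m p q) + (\<Sum>m\<in>UNIV. c p m * levi_civita n m q) + (\<Sum>m\<in>UNIV. c q m * levi_civita n p m)
    = (\<Sum>m\<in>UNIV. c m m) * levi_civita n p q"
  using exhaust_3[of n] exhaust_3[of p] exhaust_3[of q]
  by (elim disjE) (simp_all add: sum_3)

text \<open>Used twice in a row, it exchanges the two outer sums with the two inner ones.\<close>

lemma sum_rotate4:
  "(\<Sum>q\<in>D. \<Sum>m\<in>A. \<Sum>k\<in>B. \<Sum>l\<in>C. f q m k l) = (\<Sum>m\<in>A. \<Sum>k\<in>B. \<Sum>l\<in>C. \<Sum>q\<in>D. f q m k l)"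
  by (subst sum.swap[of _ A D], subst sum.swap[of _ B D], subst sum.swap[of _ C D]) (rule refl)

lemma volume_form_axis:
  "volume_form G (axis a 1) (axis k 1) (axis l 1) = sqrt (det G) * levi_civita a k l"
  by (simp add: volume_form_def levi_civita_def)

lemma partial_chain_real:
  fixes f :: "real^'n::finite \<Rightarrow> real"
  assumes "f differentiable (at x)" "(\<phi> has_real_derivative d) (at (f x))"
  shows "partial k (\<lambda>y. \<phi> (f y)) x = d * partial k f x" "(\<lambda>y. \<phi> (f y)) differentiable (at x)"
proof -
  have D: "((\<lambda>y. \<phi> (f y)) has_derivative (\<lambda>v. d * frechet_derivative f (at x) v)) (at x)"
    using has_derivative_compose[OF has_derivative_frechet[OF assms(1)], of \<phi> "(*) d"] assms(2)
    by (simp add: has_field_derivative_def)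
  show "partial k (\<lambda>y. \<phi> (f y)) x = d * partial k f x"
    using partialI[OF D, of k] by (simp add: partial_def)
  show "(\<lambda>y. \<phi> (f y)) differentiable (at x)" using D unfolding differentiable_def by blast
qed

section \<open>The volume form: parallelism and products\<close>

context riemannian_chart
begin

text \<open>$\epsilon_a{}^{pq}$; the cofactor formula turns the two inverse metrics that raise the indices
  into the single metric used here (\<open>vol_raised_eq\<close>).\<close>
definition vol_raised :: "real^3 \<Rightarrow> 3 \<Rightarrow> 3 \<Rightarrow> 3 \<Rightarrow> real" where
  "vol_raised y a p q = (\<Sum>m\<in>UNIV. g y $ a $ m * levi_civita m p q) * (1 / sqrt (det (g y)))"

lemma vol_raised_antisym: "vol_raised y a q p = - vol_raised y a p q"
  by (simp add: vol_raised_def sum_negf levi_civita_antisym[of _ q p])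

text \<open>Inserting g g^-1 at the index a puts a third inverse metric on the symbol; three of them
  produce the factor det g^-1 by \<open>levi_civita_det\<close> and leave only g.\<close>

lemma vol_raised_eq:
  assumes y: "y \<in> S"
  shows "vol_raised y a p q = sqrt (det (g y)) *
    (\<Sum>k\<in>UNIV. \<Sum>l\<in>UNIV. levi_civita a k l * ginv g y $ k $ p * ginv g y $ l $ q)"
proof -
  let ?P = "ginv g y" and ?s = "sqrt (det (g y))"
  have "det (g y) * det ?P = 1"
    using matrix_inv_mult(1)[OF det_nz[OF y]] by (metis det_I det_mul ginv_def)
  then have detP: "det ?P = 1 / (?s * ?s)"
    using det_pos[OF y] by (simp add: field_simps)
  have assoc: "(\<Sum>n\<in>UNIV. (\<Sum>m\<in>UNIV. f m * Q m n) * X n) = (\<Sum>m\<in>UNIV. f m * (\<Sum>n\<in>UNIV. Q m n * X n))"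
    for f X :: "3 \<Rightarrow> real" and Q
    by (simp add: sum_3 algebra_simps)
  have "(\<Sum>k\<in>UNIV. \<Sum>l\<in>UNIV. levi_civita a k l * ?P $ k $ p * ?P $ l $ q)
    = (\<Sum>n\<in>UNIV. (\<Sum>m\<in>UNIV. g y $ a $ m * ?P $ m $ n) * (\<Sum>k\<in>UNIV. \<Sum>l\<in>UNIV. levi_civita n k l * ?P $ k $ p * ?P $ l $ q))"
    by (simp only: ginv_sum(1)[OF y] sum_delta_mult)
  also have "\<dots> = (\<Sum>m\<in>UNIV. g y $ a $ m * (\<Sum>n\<in>UNIV. ?P $ m $ n * (\<Sum>k\<in>UNIV. \<Sum>l\<in>UNIV. levi_civita n k l * ?P $ k $ p * ?P $ l $ q)))"
    by (rule assoc)
  also have "\<dots> = (\<Sum>m\<in>UNIV. g y $ a $ m * (\<Sum>n\<in>UNIV. \<Sum>k\<in>UNIV. \<Sum>l\<in>UNIV. levi_civita n k l * ?P $ n $ m * ?P $ k $ p * ?P $ l $ q))"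
    unfolding sum_distrib_left
  proof (intro sum.cong refl)
    fix m n k l
    show "g y $ a $ m * (?P $ m $ n * (levi_civita n k l * ?P $ k $ p * ?P $ l $ q)) =
      g y $ a $ m * (levi_civita n k l * ?P $ n $ m * ?P $ k $ p * ?P $ l $ q)"
      by (subst ginv_sym[OF y, of m n]) simp
  qed
  also have "\<dots> = (\<Sum>m\<in>UNIV. g y $ a $ m * levi_civita m p q) / (?s * ?s)"
    unfolding levi_civita_det detP by (simp add: sum_divide_distrib)
  finally have raised: "(\<Sum>k\<in>UNIV. \<Sum>l\<in>UNIV. levi_civita a k l * ?P $ k $ p * ?P $ l $ q)
    = (\<Sum>m\<in>UNIV. g y $ a $ m * levi_civita m p q) / (?s * ?s)" .
  have "?s > 0" using det_pos[OF y] by simp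
  then show ?thesis
    unfolding raised vol_raised_def by (simp del: real_sqrt_mult_self abs_mult_self_eq)
qed

lemma inv_sqrt_det_diff:
  assumes x: "x \<in> S"
  shows "(\<lambda>y. 1 / sqrt (det (g y))) differentiable (at x)"
    "partial k (\<lambda>y. 1 / sqrt (det (g y))) x = - (\<Sum>m\<in>UNIV. christoffel g x m k m) * (1 / sqrt (det (g x)))"
proof -
  have detd: "(\<lambda>y. det (g y)) differentiable (at x)"
    by (rule differentiable_det_3[OF g_diff(1)[OF x]])
  have "((\<lambda>d. 1 / sqrt d) has_real_derivative - (1 / sqrt (det (g x)) / (2 * det (g x)))) (at (det (g x)))"
    using det_pos[OF x] by (auto intro!: derivative_eq_intros simp: field_simps)
  note s = partial_chain_real[OF detd this]
  show "(\<lambda>y. 1 / sqrt (det (g y))) differentiable (at x)" by (rule s(2))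
  show "partial k (\<lambda>y. 1 / sqrt (det (g y))) x = - (\<Sum>m\<in>UNIV. christoffel g x m k m) * (1 / sqrt (det (g x)))"
    using s(1)[of k] det_pos[OF x] by (simp add: partial_det[OF x] field_simps)
qed

lemma vol_raised_diff: "x \<in> S \<Longrightarrow> (\<lambda>y. vol_raised y a p q) differentiable (at x)"
  unfolding vol_raised_def
  by (intro differentiable_mult differentiable_sum ballI finite g_diff differentiable_const inv_sqrt_det_diff)

text \<open>This is the vanishing of the covariant derivative of \<epsilon>, with a lowered and p, q
  raised. The trace term from 1/sqrt(det g) combines with the second half of the derivative of g
  through \<open>levi_civita_trace\<close>.\<close>

lemma partial_vol_raised:
  assumes x: "x \<in> S"
  shows "partial k (\<lambda>y. vol_raised y a p q) x = (\<Sum>m\<in>UNIV. christoffel g x m k a * vol_raised x m p q)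
    - (\<Sum>m\<in>UNIV. christoffel g x p k m * vol_raised x a m q) - (\<Sum>m\<in>UNIV. christoffel g x q k m * vol_raised x a p m)"
proof -
  let ?c = "\<lambda>m n. christoffel g x m k n" and ?s = "1 / sqrt (det (g x))"
  let ?e = levi_civita
  have "partial k (\<lambda>y. vol_raised y a p q) x =
      (\<Sum>m\<in>UNIV. partial k (\<lambda>y. g y $ a $ m) x * ?e m p q) * ?s
      + (\<Sum>m\<in>UNIV. g x $ a $ m * ?e m p q) * (- (\<Sum>m\<in>UNIV. ?c m m) * ?s)"
    unfolding vol_raised_def inv_sqrt_det_diff(2)[OF x, symmetric]
    by (subst partial_mult)
      (simp_all add: partial_sum partial_mult inv_sqrt_det_diff(1)[OF x] differentiable_sum differentiable_mult g_diff[OF x])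
  also have "\<dots> = (\<Sum>n\<in>UNIV. ?c n a * (\<Sum>m\<in>UNIV. g x $ n $ m * ?e m p q)) * ?s
      + (\<Sum>n\<in>UNIV. g x $ a $ n * ((\<Sum>m\<in>UNIV. ?c n m * ?e m p q) - (\<Sum>m\<in>UNIV. ?c m m) * ?e n p q)) * ?s"
    unfolding partial_g[OF x] by (simp add: sum_3 algebra_simps)
  also have "\<dots> = (\<Sum>n\<in>UNIV. ?c n a * (\<Sum>m\<in>UNIV. g x $ n $ m * ?e m p q)) * ?s
      - (\<Sum>n\<in>UNIV. g x $ a $ n * ((\<Sum>m\<in>UNIV. ?c p m * ?e n m q) + (\<Sum>m\<in>UNIV. ?c q m * ?e n p m))) * ?s"
    unfolding levi_civita_trace[of ?c _ p q, symmetric] by (simp add: sum_3 algebra_simps)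
  also have "\<dots> = (\<Sum>m\<in>UNIV. ?c m a * vol_raised x m p q)
    - (\<Sum>m\<in>UNIV. ?c p m * vol_raised x a m q) - (\<Sum>m\<in>UNIV. ?c q m * vol_raised x a p m)"
    unfolding vol_raised_def by (simp add: sum_3 algebra_simps)
  finally show ?thesis .
qed

lemma nabla_vol_contract:
  assumes x: "x \<in> S" and T: "\<And>a b c. (\<lambda>y. T y a b c) differentiable (at x)"
  shows "partial k (\<lambda>y. \<Sum>r\<in>UNIV. \<Sum>s\<in>UNIV. vol_raised y q r s * T y r s b) x
      - (\<Sum>m\<in>UNIV. christoffel g x m k q * (\<Sum>r\<in>UNIV. \<Sum>s\<in>UNIV. vol_raised x m r s * T x r s b))
      - (\<Sum>m\<in>UNIV. christoffel g x m k b * (\<Sum>r\<in>UNIV. \<Sum>s\<in>UNIV. vol_raised x q r s * T x r s m))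
    = (\<Sum>r\<in>UNIV. \<Sum>s\<in>UNIV. vol_raised x q r s * nabla3 g T x k r s b)"
proof -
  have "partial k (\<lambda>y. \<Sum>r\<in>UNIV. \<Sum>s\<in>UNIV. vol_raised y q r s * T y r s b) x = (\<Sum>r\<in>UNIV. \<Sum>s\<in>UNIV.
      partial k (\<lambda>y. vol_raised y q r s) x * T x r s b + vol_raised x q r s * partial k (\<lambda>y. T y r s b) x)"
    by (simp add: partial_sum partial_mult differentiable_mult differentiable_sum vol_raised_diff x T)
  then show ?thesis
    unfolding partial_vol_raised[OF x] nabla3_def by (simp add: sum_3 algebra_simps)
qed

lemma vol_raised_prod:
  assumes x: "x \<in> S"
  shows "vol_raised x a p q * vol_raised x b r s =
    (\<Sum>m\<in>UNIV. \<Sum>k\<in>UNIV. \<Sum>l\<in>UNIV. g x $ a $ m * ginv g x $ k $ r * ginv g x $ l $ s * (levi_civita m p q * levi_civita b k l))"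
proof -
  have prod: "(A * (1 / t)) * (t * B) = A * B" if "t \<noteq> 0" for A B t :: real
    using that by simp
  have nz: "sqrt (det (g x)) \<noteq> 0" using det_pos[OF x] by simp
  have expand: "(\<Sum>m\<in>UNIV. G m * e m) * (\<Sum>k\<in>UNIV. \<Sum>l\<in>UNIV. e' k l * P k * Q l)
    = (\<Sum>m\<in>UNIV. \<Sum>k\<in>UNIV. \<Sum>l\<in>UNIV. G m * P k * Q l * (e m * e' k l))"
    for G e P Q :: "3 \<Rightarrow> real" and e'
    by (simp add: sum_3 algebra_simps)
  \<comment> \<open>One factor is expanded with a single metric, the other with two inverse metrics,
    so that the powers of det g cancel.\<close>
  show ?thesis
    unfolding vol_raised_eq[OF x, of b] vol_raised_def[of x a] prod[OF nz] by (rule expand)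
qed

lemma vol_raised_contract1:
  assumes x: "x \<in> S"
  shows "(\<Sum>q\<in>UNIV. vol_raised x a p q * vol_raised x q r s) =
    (if a = r then 1 else 0) * ginv g x $ p $ s - (if a = s then 1 else 0) * ginv g x $ p $ r"
proof -
  let ?d = "\<lambda>i j::3. if i = j then 1 else (0::real)" and ?P = "\<lambda>i j. ginv g x $ i $ j"
  have "(\<Sum>q\<in>UNIV. vol_raised x a p q * vol_raised x q r s) =
    (\<Sum>m\<in>UNIV. \<Sum>k\<in>UNIV. \<Sum>l\<in>UNIV. g x $ a $ m * ?P k r * ?P l s * (\<Sum>q\<in>UNIV. levi_civita m p q * levi_civita q k l))"
    unfolding vol_raised_prod[OF x] sum_distrib_left
    by (rule sum_rotate4)
  also have "\<dots> = (\<Sum>m\<in>UNIV. g x $ a $ m * ?P m r) * ?P p s - (\<Sum>m\<in>UNIV. g x $ a $ m * ?P m s) * ?P p r"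
    unfolding levi_civita_contract
    using exhaust_3[of p] by (elim disjE) (simp_all add: sum_3 algebra_simps)
  finally show ?thesis by (simp only: ginv_sum(1)[OF x])
qed

lemma vol_raised_prod_eq:
  assumes x: "x \<in> S"
  defines "\<delta> \<equiv> \<lambda>i j::3. if i = j then 1 else (0::real)"
  shows "vol_raised x a p q * vol_raised x b r s =
    g x $ a $ b * (ginv g x $ p $ r * ginv g x $ q $ s - ginv g x $ p $ s * ginv g x $ q $ r)
    - \<delta> a r * (\<delta> p b * ginv g x $ q $ s - ginv g x $ p $ s * \<delta> q b)
    + \<delta> a s * (\<delta> p b * ginv g x $ q $ r - ginv g x $ p $ r * \<delta> q b)"
proof -
  let ?P = "\<lambda>i j. ginv g x $ i $ j"
  have "vol_raised x a p q * vol_raised x b r s =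
    g x $ a $ b * (?P p r * ?P q s - ?P p s * ?P q r)
    - (\<Sum>m\<in>UNIV. g x $ a $ m * ?P m r) * (\<delta> p b * ?P q s - ?P p s * \<delta> q b)
    + (\<Sum>m\<in>UNIV. g x $ a $ m * ?P m s) * (\<delta> p b * ?P q r - ?P p r * \<delta> q b)"
    unfolding vol_raised_prod[OF x] levi_civita_prod \<delta>_def
    using exhaust_3[of p] exhaust_3[of q] exhaust_3[of b]
    by (elim disjE) (simp_all add: sum_3 algebra_simps)
  then show ?thesis by (simp only: ginv_sum(1)[OF x] \<delta>_def)
qed

end


section \<open>The square of the Dirac-type operator\<close>

context riemannian_chart
begin

text \<open>Antisymmetry of \<epsilon> makes the two terms of the difference equal, and this factor
  2 cancels the 1/2 of \<open>Sym\<close>.\<close>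

lemma dirac_component:
  assumes y: "y \<in> S"
  shows "dirac g h y $ a $ b =
    (\<Sum>p\<in>UNIV. \<Sum>q\<in>UNIV. vol_raised y a p q * nabla_tensor g h y p q b)
    + (\<Sum>p\<in>UNIV. \<Sum>q\<in>UNIV. vol_raised y b p q * nabla_tensor g h y p q a)"
proof -
  let ?N = "nabla_tensor g h y" and ?P = "ginv g y" and ?s = "sqrt (det (g y))"
  have F: "(\<Sum>k\<in>UNIV. \<Sum>l\<in>UNIV. \<Sum>p\<in>UNIV. \<Sum>q\<in>UNIV.
        volume_form (g y) (axis a 1) (axis k 1) (axis l 1) * ?P $ k $ p * ?P $ l $ q * (?N p q b - ?N q p b))
     = 2 * (\<Sum>p\<in>UNIV. \<Sum>q\<in>UNIV. vol_raised y a p q * ?N p q b)" for a b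
  proof -
    have "(\<Sum>k\<in>UNIV. \<Sum>l\<in>UNIV. \<Sum>p\<in>UNIV. \<Sum>q\<in>UNIV.
        volume_form (g y) (axis a 1) (axis k 1) (axis l 1) * ?P $ k $ p * ?P $ l $ q * (?N p q b - ?N q p b))
      = (\<Sum>p\<in>UNIV. \<Sum>q\<in>UNIV. \<Sum>k\<in>UNIV. \<Sum>l\<in>UNIV.
        volume_form (g y) (axis a 1) (axis k 1) (axis l 1) * ?P $ k $ p * ?P $ l $ q * (?N p q b - ?N q p b))"
      by (rule trans[OF sum_rotate4 sum_rotate4])
    also have "\<dots> = (\<Sum>p\<in>UNIV. \<Sum>q\<in>UNIV. vol_raised y a p q * (?N p q b - ?N q p b))"
      unfolding vol_raised_eq[OF y] volume_form_axis
      by (simp add: sum_distrib_left sum_distrib_right mult_ac)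
    also have "\<dots> = (\<Sum>p\<in>UNIV. \<Sum>q\<in>UNIV. vol_raised y a p q * ?N p q b) - (\<Sum>p\<in>UNIV. \<Sum>q\<in>UNIV. vol_raised y a p q * ?N q p b)"
      by (simp add: right_diff_distrib sum_subtractf)
    also have "(\<Sum>p\<in>UNIV. \<Sum>q\<in>UNIV. vol_raised y a p q * ?N q p b) = - (\<Sum>p\<in>UNIV. \<Sum>q\<in>UNIV. vol_raised y a p q * ?N p q b)"
    proof -
      have "(\<Sum>p\<in>UNIV. \<Sum>q\<in>UNIV. vol_raised y a p q * ?N q p b) = (\<Sum>q\<in>UNIV. \<Sum>p\<in>UNIV. vol_raised y a p q * ?N q p b)"
        by (rule sum.swap)
      also have "\<dots> = (\<Sum>q\<in>UNIV. \<Sum>p\<in>UNIV. - (vol_raised y a q p * ?N q p b))"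
        by (intro sum.cong refl, subst vol_raised_antisym) simp
      finally show ?thesis by (simp add: sum_negf)
    qed
    finally show ?thesis by simp
  qed
  show ?thesis
    unfolding dirac_eq[where g = g and x = y, OF transpose_metric[OF y] pos[OF y]] dirac_coord_def Sym_def
    by (simp add: F)
qed

text \<open>The explicit components hold on the whole chart and can be differentiated; since
  \<epsilon> is parallel, the derivative falls on the derivative of h alone.\<close>

lemma nabla_dirac:
  assumes x: "x \<in> S" and h: "\<And>i j. C_k_on 2 S (\<lambda>y. h y $ i $ j)"
  shows "nabla_tensor g (dirac g h) x p q b =
    (\<Sum>r\<in>UNIV. \<Sum>s\<in>UNIV. vol_raised x q r s * nabla3 g (nabla_tensor g h) x p r s b)
    + (\<Sum>r\<in>UNIV. \<Sum>s\<in>UNIV. vol_raised x b r s * nabla3 g (nabla_tensor g h) x p r s q)"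
proof -
  let ?X = "\<lambda>q b y. \<Sum>r\<in>UNIV. \<Sum>s\<in>UNIV. vol_raised y q r s * nabla_tensor g h y r s b"
  note N = nabla_tensor_diff[OF x h]
  have X: "?X q b differentiable (at x)" for q b
    by (intro differentiable_sum ballI finite differentiable_mult vol_raised_diff N x)
  have "partial p (\<lambda>y. dirac g h y $ q $ b) x = partial p (\<lambda>y. ?X q b y + ?X b q y) x"
    by (rule partial_cong_S[OF x dirac_component])
  also have "\<dots> = partial p (?X q b) x + partial p (?X b q) x" by (rule partial_add[OF X X])
  finally show ?thesis
    unfolding nabla_tensor_def[of g "dirac g h"] dirac_component[OF x]
    using nabla_vol_contract[of x "nabla_tensor g h" p q b, OF x N] nabla_vol_contract[of x "nabla_tensor g h" p b q, OF x N]
    by (simp add: distrib_left sum.distrib)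
qed

lemma trace_flip:
  assumes "x \<in> S"
  shows "(\<Sum>p\<in>UNIV. \<Sum>q\<in>UNIV. ginv g x $ p $ q * X q p) = (\<Sum>p\<in>UNIV. \<Sum>q\<in>UNIV. ginv g x $ p $ q * X p q)"
  by (subst sum.swap) (simp add: ginv_sym[OF assms])

lemma vol_contract_first:
  assumes x: "x \<in> S"
  shows "(\<Sum>p\<in>UNIV. \<Sum>q\<in>UNIV. vol_raised x a p q * (\<Sum>r\<in>UNIV. \<Sum>s\<in>UNIV. vol_raised x q r s * K p r s))
    = (\<Sum>p\<in>UNIV. \<Sum>s\<in>UNIV. ginv g x $ p $ s * K p a s) - (\<Sum>p\<in>UNIV. \<Sum>r\<in>UNIV. ginv g x $ p $ r * K p r a)"
proof -
  have assoc: "(\<Sum>q\<in>UNIV. e q * (\<Sum>r\<in>UNIV. \<Sum>s\<in>UNIV. f q r s * k r s)) = (\<Sum>r\<in>UNIV. \<Sum>s\<in>UNIV. (\<Sum>q\<in>UNIV. e q * f q r s) * k r s)"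
    for e :: "3 \<Rightarrow> real" and f :: "3 \<Rightarrow> 3 \<Rightarrow> 3 \<Rightarrow> real" and k
    by (simp add: sum_3 algebra_simps)
  have "(\<Sum>q\<in>UNIV. vol_raised x a p q * (\<Sum>r\<in>UNIV. \<Sum>s\<in>UNIV. vol_raised x q r s * K p r s))
    = (\<Sum>s\<in>UNIV. ginv g x $ p $ s * K p a s) - (\<Sum>r\<in>UNIV. ginv g x $ p $ r * K p r a)" for p
    unfolding assoc vol_raised_contract1[OF x]
    using exhaust_3[of a] by (elim disjE) (simp_all add: sum_3 algebra_simps)
  then show ?thesis by (simp add: sum_subtractf)
qed

text \<open>No index is shared by the two volume forms, so all six terms of their product survive;
  the two proportional to g are the double traces.\<close>

lemma vol_contract_second:
  assumes x: "x \<in> S"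
  shows "(\<Sum>p\<in>UNIV. \<Sum>q\<in>UNIV. vol_raised x a p q * (\<Sum>r\<in>UNIV. \<Sum>s\<in>UNIV. vol_raised x b r s * H p r s q))
    = g x $ a $ b * ((\<Sum>q\<in>UNIV. \<Sum>s\<in>UNIV. ginv g x $ q $ s * (\<Sum>p\<in>UNIV. \<Sum>r\<in>UNIV. ginv g x $ p $ r * H p r s q))
        - (\<Sum>q\<in>UNIV. \<Sum>r\<in>UNIV. ginv g x $ q $ r * (\<Sum>p\<in>UNIV. \<Sum>s\<in>UNIV. ginv g x $ p $ s * H p r s q)))
      - (\<Sum>q\<in>UNIV. \<Sum>s\<in>UNIV. ginv g x $ q $ s * H b a s q) + (\<Sum>p\<in>UNIV. \<Sum>s\<in>UNIV. ginv g x $ p $ s * H p a s b)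
      + (\<Sum>q\<in>UNIV. \<Sum>r\<in>UNIV. ginv g x $ q $ r * H b r a q) - (\<Sum>p\<in>UNIV. \<Sum>r\<in>UNIV. ginv g x $ p $ r * H p r a b)"
proof -
  have "(\<Sum>p\<in>UNIV. \<Sum>q\<in>UNIV. vol_raised x a p q * (\<Sum>r\<in>UNIV. \<Sum>s\<in>UNIV. vol_raised x b r s * H p r s q))
    = (\<Sum>p\<in>UNIV. \<Sum>q\<in>UNIV. \<Sum>r\<in>UNIV. \<Sum>s\<in>UNIV. (vol_raised x a p q * vol_raised x b r s) * H p r s q)"
    by (simp add: sum_distrib_left mult.assoc)
  then show ?thesis
    unfolding vol_raised_prod_eq[OF x]
    using exhaust_3[of a] exhaust_3[of b] by (elim disjE) (simp_all add: sum_3 algebra_simps)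
qed

end


section \<open>Contractions of the second covariant derivative\<close>

context metric_variation
begin

abbreviation hess :: "real^3 \<Rightarrow> 3 \<Rightarrow> 3 \<Rightarrow> 3 \<Rightarrow> 3 \<Rightarrow> real" where
  "hess x \<equiv> nabla3 g (nabla_tensor g h) x"

text \<open>The digits are the slots of $\nabla_i\nabla_jh_{kl}$ that are traced, so that \<open>contr23\<close> is
  $\nabla\delta h$ and \<open>contr34\<close> is the Hessian of the trace.\<close>
definition contr12 :: "real^3 \<Rightarrow> 3 \<Rightarrow> 3 \<Rightarrow> real" where
  "contr12 x a b = (\<Sum>p\<in>UNIV. \<Sum>q\<in>UNIV. ginv g x $ p $ q * hess x p q a b)"

definition contr13 :: "real^3 \<Rightarrow> 3 \<Rightarrow> 3 \<Rightarrow> real" where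
  "contr13 x a b = (\<Sum>p\<in>UNIV. \<Sum>q\<in>UNIV. ginv g x $ p $ q * hess x p a q b)"

definition contr23 :: "real^3 \<Rightarrow> 3 \<Rightarrow> 3 \<Rightarrow> real" where
  "contr23 x a b = (\<Sum>p\<in>UNIV. \<Sum>q\<in>UNIV. ginv g x $ p $ q * hess x a p q b)"

definition contr34 :: "real^3 \<Rightarrow> 3 \<Rightarrow> 3 \<Rightarrow> real" where
  "contr34 x a b = (\<Sum>p\<in>UNIV. \<Sum>q\<in>UNIV. ginv g x $ p $ q * hess x a b p q)"

definition tr2 :: "real^3 \<Rightarrow> (3 \<Rightarrow> 3 \<Rightarrow> real) \<Rightarrow> real" where
  "tr2 x X = (\<Sum>p\<in>UNIV. \<Sum>q\<in>UNIV. ginv g x $ p $ q * X p q)"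

lemma tr2_linear:
  "tr2 x (\<lambda>a b. X a b + Z a b) = tr2 x X + tr2 x Z"
  "tr2 x (\<lambda>a b. X a b - Z a b) = tr2 x X - tr2 x Z"
  "tr2 x (\<lambda>a b. c * X a b) = c * tr2 x X"
  "tr2 x (\<lambda>a b. X a b / c) = tr2 x X / c"
  by (simp_all add: tr2_def distrib_left right_diff_distrib sum.distrib sum_subtractf sum_distrib_left
      sum_divide_distrib mult_ac)

lemma tr2_flip: "x \<in> S \<Longrightarrow> tr2 x (\<lambda>a b. X b a) = tr2 x X"
  unfolding tr2_def by (rule trace_flip)

lemma tr_g_tr2: "tr_g g f x = tr2 x (\<lambda>a b. f x $ a $ b)"
  by (simp add: tr_g_def tr2_def)

lemma tr2_metric:
  assumes x: "x \<in> S"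
  shows "tr2 x (\<lambda>a b. g x $ a $ b) = 3"
proof -
  have "tr2 x (\<lambda>a b. g x $ a $ b) = (\<Sum>p\<in>UNIV. \<Sum>q\<in>UNIV. ginv g x $ p $ q * g x $ q $ p)"
    unfolding tr2_def by (rule trace_flip[OF x, symmetric])
  then show ?thesis by (simp add: ginv_sum(2)[OF x])
qed

text \<open>In \<open>div_tensor\<close> the first summation index sits in h and the second in the
  derivative, the reverse of \<open>contr23\<close>; hence the permuted tensor and the flipped
  trace.\<close>

lemma nabla_form_div:
  assumes x: "x \<in> S"
  shows "nabla_form g (div_tensor g h) x $ a $ b = contr23 x a b"
proof -
  have "nabla_form g (div_tensor g h) x $ a $ b
    = (\<Sum>p\<in>UNIV. \<Sum>q\<in>UNIV. ginv g x $ p $ q * nabla3 g (\<lambda>y p q. nabla_tensor g h y q p) x a p q b)"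
    using nabla_contract[of x "\<lambda>y p q. nabla_tensor g h y q p" a b, OF x nabla_tensor_diff[OF x h_smooth]]
    by (simp add: nabla_form_def div_tensor_def)
  also have "\<dots> = (\<Sum>p\<in>UNIV. \<Sum>q\<in>UNIV. ginv g x $ p $ q * hess x a q p b)"
    by (simp add: nabla3_def algebra_simps)
  finally show ?thesis
    unfolding contr23_def using trace_flip[OF x, of "\<lambda>p q. hess x a p q b"] by simp
qed

lemma hessian_trace:
  assumes x: "x \<in> S"
  shows "hessian g (tr_g g h) x $ a $ b = contr34 x a b"
proof -
  let ?C = "\<lambda>b y. \<Sum>p\<in>UNIV. \<Sum>q\<in>UNIV. ginv g y $ p $ q * nabla_tensor g h y b p q"
  have t: "partial b (tr_g g h) y = ?C b y" if "y \<in> S" for b y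
    by (rule partial_trace[OF that h_diff(1)[OF that]])
  have "partial a (\<lambda>y. partial b (tr_g g h) y) x = partial a (?C b) x"
    by (rule partial_cong_S[OF x t])
  then have "hessian g (tr_g g h) x $ a $ b
    = (\<Sum>p\<in>UNIV. \<Sum>q\<in>UNIV. ginv g x $ p $ q * nabla3 g (\<lambda>y p q b. nabla_tensor g h y b p q) x a p q b)"
    using nabla_contract[of x "\<lambda>y p q b. nabla_tensor g h y b p q" a b, OF x nabla_tensor_diff[OF x h_smooth]]
    by (simp add: hessian_def nabla_form_def t[OF x])
  then show ?thesis
    by (simp add: contr34_def nabla3_def algebra_simps)
qed

text \<open>\<open>W\<close> is the curl of X + X^T, where X is the curl of h: the summand X shares
  a summed index with the outer \<epsilon>, the summand X^T does not, which separates the two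
  contraction lemmas. No derivatives are commuted, so this holds in any curvature.\<close>

lemma dirac_dirac:
  assumes x: "x \<in> S"
  defines "W \<equiv> \<lambda>a b. 2 * contr13 x a b - 2 * contr12 x a b - contr34 x b a + contr23 x b a
    + g x $ a $ b * (tr2 x (contr12 x) - tr2 x (contr13 x))"
  shows "dirac g (dirac g h) x $ a $ b = W a b + W b a"
proof -
  have *: "(\<Sum>p\<in>UNIV. \<Sum>q\<in>UNIV. vol_raised x a p q * nabla_tensor g (dirac g h) x p q b) = W a b" for a b
  proof -
    have s1: "(\<Sum>q\<in>UNIV. \<Sum>s\<in>UNIV. ginv g x $ q $ s * hess x b a s q) = contr34 x b a"
      unfolding contr34_def by (rule trace_flip[OF x])
    have s2: "(\<Sum>q\<in>UNIV. \<Sum>r\<in>UNIV. ginv g x $ q $ r * hess x b r a q) = contr23 x b a"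
      unfolding contr23_def nabla2_sym[OF x, of b _ a] by (rule trace_flip[OF x])
    have s3: "(\<Sum>q\<in>UNIV. \<Sum>s\<in>UNIV. ginv g x $ q $ s * contr12 x s q) = tr2 x (contr12 x)"
      "(\<Sum>q\<in>UNIV. \<Sum>s\<in>UNIV. ginv g x $ q $ s * contr13 x s q) = tr2 x (contr13 x)"
      unfolding tr2_def by (rule trace_flip[OF x])+
    show ?thesis
      unfolding nabla_dirac[OF x h_smooth] distrib_left sum.distrib
        vol_contract_first[OF x, of a "\<lambda>p r s. hess x p r s b"] vol_contract_second[OF x, of a b "hess x"]
        s1 s2 contr12_def[symmetric] contr13_def[symmetric] s3
      by (simp add: W_def)
  qed
  show ?thesis unfolding dirac_component[OF x] * ..
qed

lemma ricci_variation:
  assumes x: "x \<in> S"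
  shows "(\<Sum>i\<in>UNIV. riem_quotient 0 x i j i l)
    = (contr13 x l j + contr13 x j l - contr12 x l j - contr34 x l j) / 2"
proof -
  let ?H = "hess x"
  have "(\<Sum>i\<in>UNIV. riem_quotient 0 x i j i l) = tr2 x (\<lambda>i m.
      (1/2) * (?H i l j m + ?H i j l m - ?H i m l j) - (1/2) * (?H l i j m + ?H l j i m - ?H l m i j))"
    unfolding riem_quotient_0[OF x] nabla3_var_low[OF x] tr2_def by (rule refl)
  also have "\<dots> = (1/2) * (tr2 x (\<lambda>i m. ?H i l j m) + tr2 x (\<lambda>i m. ?H i j l m) - tr2 x (\<lambda>i m. ?H i m l j))
      - (1/2) * (tr2 x (\<lambda>i m. ?H l i j m) + tr2 x (\<lambda>i m. ?H l j i m) - tr2 x (\<lambda>i m. ?H l m i j))"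
    by (simp only: tr2_linear)
  also have "tr2 x (\<lambda>i m. ?H i l j m) = contr13 x l j"
    unfolding contr13_def tr2_def nabla2_sym[OF x, of _ l j] by (rule refl)
  also have "tr2 x (\<lambda>i m. ?H i j l m) = contr13 x j l"
    unfolding contr13_def tr2_def nabla2_sym[OF x, of _ j l] by (rule refl)
  also have "tr2 x (\<lambda>i m. ?H i m l j) = contr12 x l j"
    unfolding contr12_def tr2_def by (rule refl)
  also have "tr2 x (\<lambda>i m. ?H l j i m) = contr34 x l j"
    unfolding contr34_def tr2_def by (rule refl)
  \<comment> \<open>These two contributions to the Palatini formula cancel, because the trace is
    symmetric in i and m and h is symmetric.\<close>
  also have "tr2 x (\<lambda>i m. ?H l i j m) = tr2 x (\<lambda>i m. ?H l m i j)"
    using tr2_flip[OF x, of "\<lambda>i m. ?H l m i j"] nabla2_sym[OF x, of l _ j] by simp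
  finally show ?thesis by simp
qed

lemma tr2_metric_contract:
  assumes x: "x \<in> S"
  shows "tr2 x (\<lambda>p q. g x $ q $ a * X p) = X a" "tr2 x (\<lambda>p q. g x $ a $ p * X q) = X a"
proof -
  show *: "tr2 x (\<lambda>p q. g x $ q $ a * X p) = X a"
  proof -
    have "tr2 x (\<lambda>p q. g x $ q $ a * X p) = (\<Sum>p\<in>UNIV. (\<Sum>q\<in>UNIV. ginv g x $ p $ q * g x $ q $ a) * X p)"
      by (simp add: tr2_def sum_distrib_left sum_distrib_right mult_ac)
    then show ?thesis by (simp only: ginv_sum(2)[OF x] sum_delta_mult)
  qed
  have "tr2 x (\<lambda>p q. g x $ a $ p * X q) = tr2 x (\<lambda>p q. g x $ a $ q * X p)"
    by (rule tr2_flip[OF x])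
  then show "tr2 x (\<lambda>p q. g x $ a $ p * X q) = X a"
    using * by (simp add: sym[OF x, of a])
qed

section \<open>First variation at a point of constant curvature\<close>

context
  fixes x :: "real^3" and \<kappa> :: real
  assumes x: "x \<in> S"
    and curv: "\<And>i j k l. riem g x i j k l =
      \<kappa> * ((if i = k then 1 else 0) * g x $ j $ l - (if i = l then 1 else 0) * g x $ j $ k)"
begin

lemma hess_commute:
  "hess x k l i j - hess x l k i j = \<kappa> * (g x $ i $ k * h x $ l $ j - g x $ i $ l * h x $ k $ j
     + g x $ j $ k * h x $ i $ l - g x $ j $ l * h x $ i $ k)"
proof -
  have contr: "(\<Sum>m\<in>UNIV. riem g x m i k l * X m) = \<kappa> * (g x $ i $ l * X k - g x $ i $ k * X l)" for i X
  proof -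
    have "(\<Sum>m\<in>UNIV. riem g x m i k l * X m) = \<kappa> * (g x $ i $ l * (\<Sum>m\<in>UNIV. (if m = k then 1 else 0) * X m)
       - g x $ i $ k * (\<Sum>m\<in>UNIV. (if m = l then 1 else 0) * X m))"
      unfolding curv by (simp only: sum_distrib_left sum_subtractf[symmetric] left_diff_distrib right_diff_distrib mult_ac)
    then show ?thesis by (simp only: sum_delta_mult)
  qed
  show ?thesis
    unfolding ricci_identity[OF x h_smooth] contr[of i "\<lambda>m. h x $ m $ j"] contr[of j "\<lambda>m. h x $ i $ m"]
    by (simp add: algebra_simps)
qed

text \<open>The factor 3 is the trace of the metric; the two other terms in h, of opposite signs,
  cancel by symmetry.\<close>

lemma contr13_eq: "contr13 x a b = contr23 x a b + 3 * \<kappa> * h x $ a $ b - \<kappa> * tr_g g h x * g x $ a $ b"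
proof -
  have "contr13 x a b - contr23 x a b = tr2 x (\<lambda>p q. hess x p a q b - hess x a p q b)"
    by (simp add: contr13_def contr23_def tr2_def right_diff_distrib sum_subtractf)
  also have "\<dots> = tr2 x (\<lambda>p q. \<kappa> * (h x $ a $ b * g x $ q $ p - g x $ q $ a * h x $ p $ b
     + g x $ b $ p * h x $ q $ a - g x $ b $ a * h x $ q $ p))"
    unfolding hess_commute by (simp only: mult.commute[of "g x $ _ $ _" "h x $ a $ b"])
  also have "\<dots> = \<kappa> * (h x $ a $ b * tr2 x (\<lambda>p q. g x $ q $ p) - h x $ a $ b + h x $ b $ a
     - g x $ b $ a * tr2 x (\<lambda>p q. h x $ q $ p))"
    by (simp only: tr2_linear tr2_metric_contract[OF x])
  also have "\<dots> = 3 * \<kappa> * h x $ a $ b - \<kappa> * tr_g g h x * g x $ a $ b"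
    unfolding tr2_flip[OF x, of "\<lambda>p q. g x $ p $ q"] tr2_flip[OF x, of "\<lambda>p q. h x $ p $ q"] tr2_metric[OF x]
      tr_g_tr2[of h] h_sym[OF x, of b a] sym[OF x, of b a]
    by (simp add: algebra_simps)
  finally show ?thesis by simp
qed

text \<open>Commuting the derivatives changes h by the action of the curvature, and the four traced
  terms of that action cancel in pairs.\<close>

lemma contr34_sym: "contr34 x a b = contr34 x b a"
proof -
  have "contr34 x a b - contr34 x b a = tr2 x (\<lambda>p q. hess x a b p q - hess x b a p q)"
    by (simp add: contr34_def tr2_def right_diff_distrib sum_subtractf)
  also have "\<dots> = tr2 x (\<lambda>p q. \<kappa> * (g x $ a $ p * h x $ b $ q - g x $ b $ p * h x $ a $ q
     + g x $ q $ a * h x $ p $ b - g x $ q $ b * h x $ p $ a))"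
    unfolding hess_commute by (simp only: sym[OF x, of _ a] sym[OF x, of _ b])
  also have "\<dots> = 0"
    by (simp only: tr2_linear tr2_metric_contract[OF x]) (simp add: h_sym[OF x, of b a])
  finally show ?thesis by simp
qed

lemma ricci_curv: "ricci g x $ j $ l = 2 * \<kappa> * g x $ j $ l"
proof -
  have "ricci g x $ j $ l = \<kappa> * (3 * g x $ j $ l - (\<Sum>i\<in>UNIV. (if i = l then 1 else 0) * g x $ j $ i))"
    unfolding ricci_def curv by (simp add: sum_subtractf sum_distrib_left right_diff_distrib)
  then show ?thesis by (simp only: sum_delta_mult) simp
qed

lemma ricci_varied_deriv:
  "((\<lambda>t. ricci (varied t) x $ j $ l) has_real_derivative
     (contr23 x j l + contr23 x l j - contr12 x l j - contr34 x l j) / 2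
     + 3 * \<kappa> * h x $ j $ l - \<kappa> * tr_g g h x * g x $ j $ l) (at 0)"
proof -
  have "((\<lambda>t. ricci (varied t) x $ j $ l) has_real_derivative (\<Sum>i\<in>UNIV. riem_quotient 0 x i j i l)) (at 0)"
    unfolding ricci_def by (simp only: vec_lambda_beta) (intro DERIV_sum riem_varied_deriv x)
  then show ?thesis
    unfolding ricci_variation[OF x] contr13_eq h_sym[OF x, of l j] sym[OF x, of l j]
    by (simp add: field_simps)
qed

lemma tr2_inverse_deriv:
  "(\<Sum>a\<in>UNIV. \<Sum>b\<in>UNIV. - (\<Sum>m\<in>UNIV. (\<Sum>l\<in>UNIV. ginv g x $ a $ l * h x $ l $ m) * ginv g x $ m $ b) * g x $ a $ b)
    = - tr_g g h x"
proof -
  have "(\<Sum>b\<in>UNIV. - (\<Sum>m\<in>UNIV. f m * ginv g x $ m $ b) * g x $ a $ b) = - f a" for f a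
  proof -
    have "(\<Sum>b\<in>UNIV. - (\<Sum>m\<in>UNIV. f m * ginv g x $ m $ b) * g x $ a $ b)
      = - (\<Sum>b\<in>UNIV. (\<Sum>m\<in>UNIV. f m * ginv g x $ m $ b) * g x $ b $ a)"
      by (simp add: sum_negf sym[OF x, of a])
    then show ?thesis by (simp only: contract_inverse[OF ginv_sum(2)[OF x]])
  qed
  then have "(\<Sum>a\<in>UNIV. \<Sum>b\<in>UNIV. - (\<Sum>m\<in>UNIV. (\<Sum>l\<in>UNIV. ginv g x $ a $ l * h x $ l $ m) * ginv g x $ m $ b) * g x $ a $ b)
    = - (\<Sum>a\<in>UNIV. \<Sum>l\<in>UNIV. ginv g x $ a $ l * h x $ l $ a)"
    by (simp add: sum_negf)
  then show ?thesis
    using trace_flip[OF x, of "\<lambda>a l. h x $ a $ l"] by (simp add: tr_g_def)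
qed

text \<open>The first is an exchange of the two traces. In the second, the curvature terms of
  \<open>contr13_eq\<close> form 3 \<kappa> times the traceless part of h and do not
  contribute.\<close>

lemma contr_trace_eq:
  "tr2 x (contr12 x) = tr2 x (contr34 x)" "tr2 x (contr13 x) = tr2 x (contr23 x)"
proof -
  have "tr2 x (contr12 x) = (\<Sum>a\<in>UNIV. \<Sum>b\<in>UNIV. \<Sum>p\<in>UNIV. \<Sum>q\<in>UNIV. ginv g x $ a $ b * (ginv g x $ p $ q * hess x p q a b))"
    by (simp add: tr2_def contr12_def sum_distrib_left)
  also have "\<dots> = (\<Sum>p\<in>UNIV. \<Sum>q\<in>UNIV. \<Sum>a\<in>UNIV. \<Sum>b\<in>UNIV. ginv g x $ a $ b * (ginv g x $ p $ q * hess x p q a b))"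
    by (rule trans[OF sum_rotate4 sum_rotate4])
  also have "\<dots> = tr2 x (contr34 x)"
    by (simp add: tr2_def contr34_def sum_distrib_left mult.left_commute)
  finally show "tr2 x (contr12 x) = tr2 x (contr34 x)" .
  have "tr2 x (contr13 x) = tr2 x (\<lambda>a b. contr23 x a b + 3 * \<kappa> * h x $ a $ b - \<kappa> * tr_g g h x * g x $ a $ b)"
    by (simp only: contr13_eq[abs_def])
  also have "\<dots> = tr2 x (contr23 x)"
    by (simp only: tr2_linear tr2_metric[OF x] tr_g_tr2[of h, symmetric])
  finally show "tr2 x (contr13 x) = tr2 x (contr23 x)" .
qed

lemma contr12_sym: "contr12 x a b = contr12 x b a"
  unfolding contr12_def by (intro sum.cong refl arg_cong2[where f = "(*)"] nabla2_sym[OF x])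

text \<open>The curvature terms of Ric' are trace free; the term in \<kappa> comes only from the
  derivative of the inverse metric, traced against Ric = 2 \<kappa> g.\<close>

lemma scal_varied_deriv:
  "((\<lambda>t. scal (varied t) x) has_real_derivative
     tr2 x (contr23 x) - tr2 x (contr34 x) - 2 * \<kappa> * tr_g g h x) (at 0)"
proof -
  let ?P' = "\<lambda>a b. - (\<Sum>m\<in>UNIV. (\<Sum>l\<in>UNIV. ginv g x $ a $ l * h x $ l $ m) * ginv g x $ m $ b)"
  let ?R' = "\<lambda>j l. (contr23 x j l + contr23 x l j - contr12 x l j - contr34 x l j) / 2
     + 3 * \<kappa> * h x $ j $ l - \<kappa> * tr_g g h x * g x $ j $ l"
  have deriv: "((\<lambda>t. scal (varied t) x) has_real_derivative
     (\<Sum>a\<in>UNIV. \<Sum>b\<in>UNIV. ?P' a b * ricci (varied 0) x $ a $ b + ?R' a b * ginv (varied 0) x $ a $ b)) (at 0)"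
    unfolding scal_def tr_g_def[of _ "ricci (varied t)" for t]
    by (intro DERIV_sum DERIV_mult ginv_varied_deriv[OF x] ricci_varied_deriv)
  have split: "(\<Sum>a\<in>UNIV. \<Sum>b\<in>UNIV. ?P' a b * ricci (varied 0) x $ a $ b + ?R' a b * ginv (varied 0) x $ a $ b)
    = 2 * \<kappa> * (\<Sum>a\<in>UNIV. \<Sum>b\<in>UNIV. ?P' a b * g x $ a $ b) + tr2 x ?R'"
  proof -
    have "(\<Sum>a\<in>UNIV. \<Sum>b\<in>UNIV. A a b * (c * g x $ a $ b) + R a b * ginv g x $ a $ b)
      = c * (\<Sum>a\<in>UNIV. \<Sum>b\<in>UNIV. A a b * g x $ a $ b) + tr2 x R" for A R and c :: real
      by (simp add: tr2_def sum.distrib sum_distrib_left mult_ac)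
    then show ?thesis unfolding varied_0 ricci_curv .
  qed
  have tr_R: "tr2 x ?R' = (tr2 x (contr23 x) + tr2 x (\<lambda>j l. contr23 x l j) - tr2 x (\<lambda>j l. contr12 x l j)
      - tr2 x (\<lambda>j l. contr34 x l j)) / 2 + 3 * \<kappa> * tr2 x (\<lambda>j l. h x $ j $ l) - \<kappa> * tr_g g h x * tr2 x (\<lambda>j l. g x $ j $ l)"
    by (simp only: tr2_linear)
  show ?thesis
    using deriv
    unfolding split tr2_inverse_deriv tr_R tr2_flip[OF x, of "contr23 x"]
      tr2_flip[OF x, of "contr12 x"] tr2_flip[OF x, of "contr34 x"] contr_trace_eq(1) tr2_metric[OF x] tr_g_tr2[of h, symmetric]
    by (rule DERIV_cong) (simp add: field_simps)
qed

lemma tf_ricci_varied_deriv: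
  "((\<lambda>t. tf_ricci (varied t) x) has_vector_derivative
     (1/8) *\<^sub>R dirac g (dirac g h) x - (1/4) *\<^sub>R tf_hessian g (tr_g g h) x
     + (1/8) *\<^sub>R conf_killing g (div_tensor g h) x - (\<kappa>/2) *\<^sub>R tf g h x) (at 0)"
    (is "(_ has_vector_derivative ?D) _")
proof (rule has_vector_derivative_matrixI)
  fix a b
  let ?B = "tr2 x (contr23 x)" and ?T = "tr2 x (contr34 x)" and ?u = "tr_g g h x"
  have lap: "laplacian g (tr_g g h) x = ?T"
    by (simp add: laplacian_def tr_g_tr2[of "hessian g (tr_g g h)"] hessian_trace[OF x])
  have div: "div_form g (div_tensor g h) x = ?B"
    by (simp add: div_form_def tr_g_tr2[of "nabla_form g (div_tensor g h)"] nabla_form_div[OF x])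
  have scal_0: "scal g x = 6 * \<kappa>"
    using tr2_metric[OF x] by (simp add: scal_def tr_g_tr2[of "ricci g"] ricci_curv tr2_linear)
  have lin: "((\<lambda>t. varied t x $ a $ b) has_real_derivative h x $ a $ b) (at 0)"
    by (auto intro!: derivative_eq_intros)
  have "((\<lambda>t. ricci (varied t) x $ a $ b - (1/3) * scal (varied t) x * varied t x $ a $ b) has_real_derivative
     ((contr23 x a b + contr23 x b a - contr12 x b a - contr34 x b a) / 2
       + 3 * \<kappa> * h x $ a $ b - \<kappa> * ?u * g x $ a $ b)
     - ((1/3) * (?B - ?T - 2 * \<kappa> * ?u) * varied 0 x $ a $ b + h x $ a $ b * ((1/3) * scal (varied 0) x))) (at 0)"
    by (intro DERIV_diff DERIV_mult DERIV_cmult ricci_varied_deriv scal_varied_deriv lin)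
  \<comment> \<open>Modulo g both sides are (B + B^T - L - T)/2 + \<kappa> h: on the left 3 \<kappa>
    loses 2 \<kappa>, a third of the scalar curvature; on the right 12/8 loses 1/2. The coefficient
    of g is (tr T - tr B - \<kappa> tr h)/3 on both sides.\<close>
  moreover have "((contr23 x a b + contr23 x b a - contr12 x b a - contr34 x b a) / 2
       + 3 * \<kappa> * h x $ a $ b - \<kappa> * ?u * g x $ a $ b)
     - ((1/3) * (?B - ?T - 2 * \<kappa> * ?u) * varied 0 x $ a $ b + h x $ a $ b * ((1/3) * scal (varied 0) x)) = ?D $ a $ b"
    unfolding varied_0 scal_0
    by (simp add: dirac_dirac[OF x] contr_trace_eq contr13_eq contr34_sym[of b a] contr12_sym[of b a] h_sym[OF x, of b a] sym[OF x, of b a]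
        tf_hessian_def conf_killing_def tf_def lap div hessian_trace[OF x] nabla_form_div[OF x] transpose_def field_simps)
  ultimately show "((\<lambda>t. tf_ricci (varied t) x $ a $ b) has_real_derivative ?D $ a $ b) (at 0)"
    by (simp add: tf_ricci_def)
qed

end

end


section \<open>From the chart to the manifold\<close>

lemma C_k_on_component:
  fixes f :: "real^'n::finite \<Rightarrow> real^'m::finite^'k::finite"
  assumes "open S" "C_k_on k S f"
  shows "C_k_on k S (\<lambda>y. f y $ i $ j)"
  by (intro C_k_on_linear[OF assms(1) bounded_linear_vec_nth] assms(2))

theorem corollaryA1:
  fixes Y :: "'a topology" and \<A> :: "'a chart set"
    and g h :: "'a tensor2" and \<kappa> :: real
  assumes "oriented_3_manifold Y \<A>"
    and "riemannian_metric \<A> g"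
    and "\<kappa> \<in> {1, 0, -1}"
    and "constant_curvature \<A> g \<kappa>"
    and "symmetric_tensor2_field \<A> h"
  shows "\<forall>c\<in>\<A>. \<forall>x\<in>chart_image c.
    ((\<lambda>t. tf_ricci (\<lambda>y. g c y + t *\<^sub>R h c y) x) has_vector_derivative
       (1/8) *\<^sub>R dirac (g c) (dirac (g c) (h c)) x
       - (1/4) *\<^sub>R tf_hessian (g c) (tr_g (g c) (h c)) x
       + (1/8) *\<^sub>R conf_killing (g c) (div_tensor (g c) (h c)) x
       - (\<kappa>/2) *\<^sub>R tf (g c) (h c) x) (at 0)"
proof (intro ballI)
  fix c x
  assume c: "c \<in> \<A>" and x: "x \<in> chart_image c"
  have "open (chart_image c)"
    using assms(1) c by (simp add: oriented_3_manifold_def is_chart_def)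
  moreover have "C_k_on 2 (chart_image c) (\<lambda>y. T c y $ i $ j)"
    if "symmetric_tensor2_field \<A> T" for T :: "'a tensor2" and i j
    using that c \<open>open (chart_image c)\<close>
    by (intro C_k_on_component) (simp_all add: symmetric_tensor2_field_def tensor2_field_def smooth_on_def)
  moreover have "T c y $ i $ j = T c y $ j $ i"
    if "symmetric_tensor2_field \<A> T" "y \<in> chart_image c" for T :: "'a tensor2" and y i j
  proof -
    have "transpose (T c y) = T c y"
      using that c by (simp add: symmetric_tensor2_field_def)
    then have "transpose (T c y) $ i $ j = T c y $ i $ j" by simp
    then show ?thesis by (simp add: transpose_def)
  qed
  ultimately interpret metric_variation "chart_image c" "g c" "h c"
    using assms(2,5) c by unfold_locales (auto simp: riemannian_metric_def)
  \<comment> \<open>Sectional curvatures at x determine the full curvature tensor there, in the form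
    that the pointwise variation formula takes as its hypothesis.\<close>
  have "riem (g c) x i j k l = \<kappa> * ((if i = k then 1 else 0) * g c x $ j $ l - (if i = l then 1 else 0) * g c x $ j $ k)"
    for i j k l
    using assms(4) c x by (intro riem_constant_curvature) (simp_all add: constant_curvature_def)
  with x show "((\<lambda>t. tf_ricci (\<lambda>y. g c y + t *\<^sub>R h c y) x) has_vector_derivative
       (1/8) *\<^sub>R dirac (g c) (dirac (g c) (h c)) x
       - (1/4) *\<^sub>R tf_hessian (g c) (tr_g (g c) (h c)) x
       + (1/8) *\<^sub>R conf_killing (g c) (div_tensor (g c) (h c)) x
       - (\<kappa>/2) *\<^sub>R tf (g c) (h c) x) (at 0)"
    by (rule tf_ricci_varied_deriv)
qed

end
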